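(* Let $G$ be an extra-special $p$-group of order $p^{2n+1}$ with $n>1$. Then $G$ has no faithful irreducible projective representation, and $\tau(G)=2p^{n/2}$ if $n$ is even, and $\tau(G)=p^{(n+1)/2}+p^{(n-1)/2}$ if $n$ is odd.
   Context: A $p$-group $G$ is extra-special if $Z(G)=G'$ has order $p$ and $G/Z(G)$ is elementary abelian. A projective representation is an $\alpha$-representation for some cocycle $\alpha\in Z^2(G,\mathbb{C}^\times)$: a map $\rho:G\to\mathrm{GL}_m(\mathbb{C})$ with $\rho(1)=I$ and $\rho(g)\rho(h)=\alpha(g,h)\rho(gh)$; it is faithful if the only $g$ with $\rho(g)$ scalar is $g=1$. $\tau(G)$ is the least degree of a faithful projective representation of $G$. *)

theory Defs
  imports "HOL-Algebra.Algebra" "Jordan_Normal_Form.Determinant"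
begin

definition group_center :: "('a, 'b) monoid_scheme \<Rightarrow> 'a set" where
  "group_center G = {z \<in> carrier G. \<forall>x \<in> carrier G. z \<otimes>\<^bsub>G\<^esub> x = x \<otimes>\<^bsub>G\<^esub> z}"

definition extra_special :: "nat \<Rightarrow> ('a, 'b) monoid_scheme \<Rightarrow> bool" where
  "extra_special p G \<longleftrightarrow>
     group G \<and> Factorial_Ring.prime p \<and> finite (carrier G) \<and> (\<exists>k. card (carrier G) = p ^ k) \<and>
     group_center G = derived G (carrier G) \<and>
     card (group_center G) = p \<and>
     comm_group (G Mod group_center G) \<and>
     (\<forall>x \<in> carrier (G Mod group_center G). x [^]\<^bsub>G Mod group_center G\<^esub> p = \<one>\<^bsub>G Mod group_center G\<^esub>)"

definition is_scalar_mat :: "nat \<Rightarrow> complex mat \<Rightarrow> bool" where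
  "is_scalar_mat m A \<longleftrightarrow> (\<exists>c. A = c \<cdot>\<^sub>m 1\<^sub>m m)"

definition alpha_rep ::
  "('a, 'b) monoid_scheme \<Rightarrow> nat \<Rightarrow> ('a \<Rightarrow> 'a \<Rightarrow> complex) \<Rightarrow> ('a \<Rightarrow> complex mat) \<Rightarrow> bool" where
  "alpha_rep G m \<alpha> \<rho> \<longleftrightarrow>
     (\<forall>g \<in> carrier G. \<rho> g \<in> carrier_mat m m \<and> det (\<rho> g) \<noteq> 0) \<and>
     \<rho> \<one>\<^bsub>G\<^esub> = 1\<^sub>m m \<and>
     (\<forall>g \<in> carrier G. \<forall>h \<in> carrier G. \<rho> g * \<rho> h = \<alpha> g h \<cdot>\<^sub>m \<rho> (g \<otimes>\<^bsub>G\<^esub> h))"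

(* 2-cocycle with values in C^x (normalisation not required) *)
definition cocycle2 :: "('a, 'b) monoid_scheme \<Rightarrow> ('a \<Rightarrow> 'a \<Rightarrow> complex) \<Rightarrow> bool" where
  "cocycle2 G \<alpha> \<longleftrightarrow>
     (\<forall>g \<in> carrier G. \<forall>h \<in> carrier G. \<alpha> g h \<noteq> 0) \<and>
     (\<forall>x \<in> carrier G. \<forall>y \<in> carrier G. \<forall>z \<in> carrier G.
        \<alpha> x y * \<alpha> (x \<otimes>\<^bsub>G\<^esub> y) z = \<alpha> y z * \<alpha> x (y \<otimes>\<^bsub>G\<^esub> z))"

definition proj_rep :: "('a, 'b) monoid_scheme \<Rightarrow> nat \<Rightarrow> ('a \<Rightarrow> complex mat) \<Rightarrow> bool" where
  "proj_rep G m \<rho> \<longleftrightarrow> (\<exists>\<alpha>. cocycle2 G \<alpha> \<and> alpha_rep G m \<alpha> \<rho>)"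

definition faithful_proj :: "('a, 'b) monoid_scheme \<Rightarrow> nat \<Rightarrow> ('a \<Rightarrow> complex mat) \<Rightarrow> bool" where
  "faithful_proj G m \<rho> \<longleftrightarrow> (\<forall>g \<in> carrier G. is_scalar_mat m (\<rho> g) \<longrightarrow> g = \<one>\<^bsub>G\<^esub>)"

definition is_subspace :: "nat \<Rightarrow> complex vec set \<Rightarrow> bool" where
  "is_subspace m W \<longleftrightarrow> W \<subseteq> carrier_vec m \<and> 0\<^sub>v m \<in> W \<and>
     (\<forall>v \<in> W. \<forall>w \<in> W. v + w \<in> W) \<and> (\<forall>c. \<forall>v \<in> W. c \<cdot>\<^sub>v v \<in> W)"

definition irreducible_proj :: "('a, 'b) monoid_scheme \<Rightarrow> nat \<Rightarrow> ('a \<Rightarrow> complex mat) \<Rightarrow> bool" where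
  "irreducible_proj G m \<rho> \<longleftrightarrow> m > 0 \<and>
     (\<forall>W. is_subspace m W \<and> (\<forall>g \<in> carrier G. \<forall>w \<in> W. \<rho> g *\<^sub>v w \<in> W)
          \<longrightarrow> W = {0\<^sub>v m} \<or> W = carrier_vec m)"

definition tau :: "('a, 'b) monoid_scheme \<Rightarrow> nat" where
  "tau G = (LEAST m. \<exists>\<rho>. proj_rep G m \<rho> \<and> faithful_proj G m \<rho>)"

end

theory Submission
  imports Defs "HOL-Library.Function_Algebras"
begin

text \<open>
  Fix a faithful character \<open>\<chi>\<close> of the centre \<open>Z\<close>; then \<open>\<beta> g h = \<chi> [g, h]\<close> is an alternating
  bicharacter with radical \<open>Z\<close>. Since \<open>n > 1\<close>, every \<open>g\<close> centralises some \<open>x, y\<close> with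
  \<open>[x, y] \<noteq> 1\<close>, so \<open>\<rho> g\<close> commutes with \<open>\<rho> [x, y]\<close> and hence with all of \<open>\<rho> Z\<close>. The eigenspaces
  of \<open>\<rho> z\<close> for \<open>1 \<noteq> z \<in> Z\<close> are therefore invariant, and there are at least two if \<open>\<rho>\<close> is faithful.

  On such an eigenspace the \<open>\<rho> g\<close> commute up to a bicharacter with radical \<open>R\<close>; if \<open>A\<close> is a
  Lagrangian (\<open>|A|\<^sup>2 = |G| |R|\<close>), then the orbit of a common eigenvector of \<open>A\<close> shows that the
  dimension is at least \<open>[G : A]\<close>, a power of \<open>p\<close>. The radicals of two eigenspaces meet in \<open>Z\<close>,
  which makes the two exponents add up to at least \<open>n\<close>. Conversely, \<open>G\<close> is a central product
  \<open>H K\<close>, and representations of \<open>H\<close> and \<open>K\<close> of degrees \<open>p\<^sup>r\<close> and \<open>p\<^sup>s\<close> with inverse central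
  characters add up to a faithful projective representation of \<open>G\<close>.
\<close>

section \<open>Eigenvectors in complex vector spaces\<close>

text \<open>The lower bound is an index count. Let \<open>p^(a_i)\<close> be the orders of the two
  Lagrangians and \<open>R_i\<close> the two radicals. Since \<open>R_1\<close> and
  \<open>R_2\<close> meet in a group of order at most p,
  \<open>|R_1| |R_2| \<le> |G| p = p^(2n+2)\<close>; together with
  \<open>|A_i|^2 = |G| |R_i|\<close> this gives \<open>a_1 + a_2 \<le> 3n + 2\<close>, so the
  exponents of the indices \<open>p^(2n+1-a_i)\<close> add up to at least n. A sum of two such
  powers is smallest when the exponents are balanced, which is how the parity of n enters the
  formula. The obstacle throughout is that a cocycle leaves relations between the operators valid
  only up to scalars. What survives is \<open>T x T y = k T [x, y] T y T x\<close> with k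
  independent of the vector, and the arguments are arranged so that such scalars cancel or can be
  compared on two eigenspaces.\<close>

locale complex_vector_space = vector_space scale
  for scale :: "complex \<Rightarrow> 'b::ab_group_add \<Rightarrow> 'b" (infixr "*s" 75)

context complex_vector_space
begin

text \<open>On the orbit of \<open>v\<close> the map satisfies X^N = c, a polynomial with N distinct
  roots as c is nonzero; discrete Fourier sums over these roots project \<open>v\<close> to
  eigenvectors. Only the orbit is involved, so the dimension is arbitrary. Individual
  \<open>e j\<close> may vanish.\<close>

lemma eigenvector_decomposition:
  assumes lin: "Vector_Spaces.linear scale scale f"
    and W: "subspace W" "f ` W \<subseteq> W" "v \<in> W"
    and N: "(f ^^ N) v = c *s v" "N > 0" "c \<noteq> 0"
  obtains e l where "v = (\<Sum>j<N. e j)" "\<And>j. e j \<in> W" "\<And>j. f (e j) = l j *s e j"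
proof -
  interpret f: Vector_Spaces.linear scale scale f by (rule lin)
  \<comment> \<open>An N-th root of c; with the primitive root of unity \<open>w\<close> below, the
    numbers \<open>r * w ^ j\<close> are all the N-th roots of c.\<close>
  define r :: complex where "r = rcis (root N (cmod c)) (Arg c / real N)"
  have rN: "r ^ N = c"
    using N by (simp add: r_def DeMoivre2 rcis_cmod_Arg)
  have r0: "r \<noteq> 0" using rN N by auto
  define w :: complex where "w = cis (2 * pi / real N)"
  have w0: "w \<noteq> 0" by (simp add: w_def)
  have wN: "w ^ N = 1" using N by (simp add: w_def DeMoivre)
  define l :: "nat \<Rightarrow> complex" where "l j = r * w ^ j" for j
  have l0: "l j \<noteq> 0" for j using r0 w0 by (simp add: l_def)
  have lN: "l j ^ N = c" for j
    by (simp add: l_def power_mult_distrib rN power_mult [symmetric] mult.commute [of j] )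
       (simp add: power_mult wN)
  define u where "u j = (\<Sum>k<N. inverse (l j) ^ k *s (f ^^ k) v)" for j
  have fk: "(f ^^ k) v \<in> W" for k
    by (induction k) (use W in auto)
  have uW: "u j \<in> W" for j
    unfolding u_def by (intro subspace_sum subspace_scale W fk)
  have eig: "f (u j) = l j *s u j" for j
  proof -
    let ?g = "\<lambda>k. inverse (l j) ^ k *s (f ^^ k) v"
    have "f (u j) = (\<Sum>k<N. l j *s ?g (Suc k))"
      unfolding u_def f.sum by (intro sum.cong refl) (simp add: f.scale l0)
    also have "\<dots> = l j *s (\<Sum>k<N. ?g (Suc k))" by (simp add: scale_sum_right)
    \<comment> \<open>Applying f has shifted the index by one; the cycle closes at k = N because
      \<open>l j ^ N = c\<close>.\<close>
    also have "(\<Sum>k<N. ?g (Suc k)) = (\<Sum>k<N. ?g k)"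
    proof -
      have "?g N = ?g 0" by (simp add: N(1) power_inverse lN N(3))
      moreover have "(\<Sum>k<Suc N. ?g k) = ?g 0 + (\<Sum>k<N. ?g (Suc k))"
        by (rule sum.lessThan_Suc_shift)
      moreover have "(\<Sum>k<Suc N. ?g k) = (\<Sum>k<N. ?g k) + ?g N" by simp
      ultimately show ?thesis by (simp add: algebra_simps)
    qed
    finally show ?thesis by (simp add: u_def)
  qed
  \<comment> \<open>Orthogonality of roots of unity: only k = 0 survives, so the \<open>u j\<close>
    add up to N times \<open>v\<close>.\<close>
  have roots: "(\<Sum>j<N. inverse (l j) ^ k) = (if k = 0 then of_nat N else 0)" if "k < N" for k
  proof (cases "k = 0")
    case False
    let ?q = "inverse w ^ k"
    have "(inverse (l j)) ^ k = inverse r ^ k * ?q ^ j" for j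
      by (simp add: l_def power_mult_distrib power_inverse flip: power_mult) (simp add: mult.commute)
    then have "(\<Sum>j<N. inverse (l j) ^ k) = inverse r ^ k * (\<Sum>j<N. ?q ^ j)"
      by (simp add: sum_distrib_left)
    moreover have "?q \<noteq> 1"
    proof
      assume "?q = 1"
      then have "w ^ k = 1" by (simp add: power_inverse)
      then have "cis (2 * pi * real k / real N) = 1" by (simp add: w_def DeMoivre mult.commute)
      then have "cos (2 * pi * real k / real N) = 1"
        by (metis cis.sel(1) one_complex.sel(1))
      then obtain i::int where i: "2 * pi * real k / real N = of_int i * 2 * pi"
        using cos_one_2pi_int by blast
      then have "real k = of_int i * real N" using N by (simp add: field_simps)
      then have "int k = i * int N"
        by (metis of_int_eq_iff of_int_mult of_int_of_nat_eq)
      then have "N dvd k" by (metis dvd_triv_right int_dvd_int_iff)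
      with that False show False by (meson dvd_imp_le not_le neq0_conv)
    qed
    moreover have "?q ^ N = 1"
      by (metis inverse_1 mult.commute power_inverse power_mult power_one wN)
    ultimately show ?thesis using False by (simp add: sum_gp_strict)
  qed simp
  have "(\<Sum>j<N. u j) = (\<Sum>k<N. (\<Sum>j<N. inverse (l j) ^ k) *s (f ^^ k) v)"
    unfolding u_def scale_sum_left by (rule sum.swap)
  also have "\<dots> = (\<Sum>k<N. if k = 0 then of_nat N *s v else 0)"
    by (intro sum.cong refl) (simp add: roots)
  also have "\<dots> = of_nat N *s v" using N by simp
  finally have tot: "(\<Sum>j<N. u j) = of_nat N *s v" .
  show thesis
  proof (rule that [of "\<lambda>j. inverse (of_nat N) *s u j" l])
    show "v = (\<Sum>j<N. inverse (of_nat N) *s u j)"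
      using N by (simp add: scale_sum_right [symmetric] tot)
    show "inverse (of_nat N) *s u j \<in> W" for j
      by (intro subspace_scale W uW)
    show "f (inverse (of_nat N) *s u j) = l j *s inverse (of_nat N) *s u j" for j
      by (simp add: f.scale eig mult.commute)
  qed
qed

text \<open>Induction on S: some eigenspace of \<open>T s\<close> inside W is nonzero by the
  decomposition, and it is invariant under the remaining operators because they commute with
  \<open>T s\<close>. The power hypothesis plays the part of diagonalisability; being stated vector
  by vector, it passes to subspaces of W.\<close>

lemma common_eigenvector:
  assumes "finite S" "subspace W" "w \<in> W" "w \<noteq> 0"
    and "\<And>s. s \<in> S \<Longrightarrow> Vector_Spaces.linear scale scale (T s)"
    and "\<And>s. s \<in> S \<Longrightarrow> T s ` W \<subseteq> W"
    and "\<And>s t v. s \<in> S \<Longrightarrow> t \<in> S \<Longrightarrow> v \<in> W \<Longrightarrow> T s (T t v) = T t (T s v)"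
    and "\<And>s v. s \<in> S \<Longrightarrow> v \<in> W \<Longrightarrow> \<exists>N>0. \<exists>c\<noteq>0. (T s ^^ N) v = c *s v"
  shows "\<exists>v\<in>W. v \<noteq> 0 \<and> (\<exists>\<psi>. \<forall>s\<in>S. T s v = \<psi> s *s v)"
  using assms
proof (induction S arbitrary: W w rule: finite_induct)
  case empty
  then show ?case by auto
next
  case (insert s S)
  interpret s: Vector_Spaces.linear scale scale "T s" by (rule insert.prems) simp
  obtain N c where N: "N > 0" "c \<noteq> 0" "(T s ^^ N) w = c *s w"
    using insert.prems(2,7) by blast
  have "T s ` W \<subseteq> W" using insert.prems by blast
  obtain e l where e: "w = (\<Sum>j<N. e j)" "\<And>j. e j \<in> W" "\<And>j. T s (e j) = l j *s e j"
    using eigenvector_decomposition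
        [OF s.linear_axioms insert.prems(1) \<open>T s ` W \<subseteq> W\<close> insert.prems(2) N(3,1,2)]
    by blast
  obtain j where j: "e j \<noteq> 0"
    using insert.prems(3) e(1) by (metis sum.neutral)
  define W' where "W' = {v \<in> W. T s v = l j *s v}"
  have sub: "subspace W'"
    using insert.prems(1) unfolding W'_def subspace_def
    by (auto simp: s.add s.scale s.zero scale_right_distrib mult.commute)
  have e': "e j \<in> W'" by (simp add: W'_def e)
  have inv: "T t ` W' \<subseteq> W'" if t: "t \<in> S" for t
  proof
    fix y assume "y \<in> T t ` W'"
    then obtain x where x: "y = T t x" "x \<in> W'" by blast
    interpret t: Vector_Spaces.linear scale scale "T t" using t by (intro insert.prems) simp
    have "T s (T t x) = T t (T s x)" by (rule insert.prems(6)) (use t x in \<open>auto simp: W'_def\<close>)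
    then show "y \<in> W'"
      using x t insert.prems(5)[of t] by (auto simp: W'_def t.scale)
  qed
  have "\<exists>v\<in>W'. v \<noteq> 0 \<and> (\<exists>\<psi>. \<forall>s\<in>S. T s v = \<psi> s *s v)"
    by (rule insert.IH [OF sub e' j _ inv])
       (use insert.prems in \<open>auto simp: W'_def\<close>)
  then obtain v \<psi> where v: "v \<in> W'" "v \<noteq> 0" "\<forall>s\<in>S. T s v = \<psi> s *s v" by blast
  have "\<forall>t\<in>insert s S. T t v = (\<psi>(s := l j)) t *s v"
    using v insert.hyps by (auto simp: W'_def)
  moreover have "v \<in> W" using v by (simp add: W'_def)
  ultimately show ?case using v(2) by blast
qed

text \<open>Families rather than sets: a repeated vector counts as a dependency, so the vectors of
  an orbit can be counted by their indices.\<close>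

definition independent_family :: "'i set \<Rightarrow> ('i \<Rightarrow> 'b) \<Rightarrow> bool" where
  "independent_family I u \<longleftrightarrow>
     (\<forall>k. (\<Sum>i\<in>I. k i *s u i) = 0 \<longrightarrow> (\<forall>i\<in>I. k i = 0))"

lemma independent_family_eigenvectors:
  assumes "finite I"
    and lin: "\<And>s. s \<in> S \<Longrightarrow> Vector_Spaces.linear scale scale (T s)"
    and eig: "\<And>i s. i \<in> I \<Longrightarrow> s \<in> S \<Longrightarrow> T s (u i) = \<phi> i s *s u i"
    and nz: "\<And>i. i \<in> I \<Longrightarrow> u i \<noteq> 0"
    and dist: "\<And>i j. i \<in> I \<Longrightarrow> j \<in> I \<Longrightarrow> i \<noteq> j \<Longrightarrow> \<exists>s\<in>S. \<phi> i s \<noteq> \<phi> j s"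
  shows "independent_family I u"
  using \<open>finite I\<close> eig nz dist
proof (induction I rule: finite_induct)
  case empty
  then show ?case by (simp add: independent_family_def)
next
  case (insert j I)
  have IH: "independent_family I u" by (rule insert.IH) (use insert.prems in auto)
  show ?case unfolding independent_family_def
  proof (intro allI impI)
    fix k assume k: "(\<Sum>i\<in>insert j I. k i *s u i) = 0"
    have kI: "k i = 0" if i: "i \<in> I" for i
    proof -
      obtain s where s: "s \<in> S" "\<phi> i s \<noteq> \<phi> j s"
        using insert.prems(3)[of i j] i insert.hyps by auto
      interpret s: Vector_Spaces.linear scale scale "T s" by (rule lin) fact
      \<comment> \<open>\<open>T s - \<phi> j s\<close> removes the j-th term of the relation and
        multiplies every other coefficient by a difference of eigenvalues, nonzero at i by the
        choice of s.\<close>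
      have "0 = T s (\<Sum>i\<in>insert j I. k i *s u i) - \<phi> j s *s (\<Sum>i\<in>insert j I. k i *s u i)"
        by (simp only: k s.zero scale_zero_right diff_self)
      also have "\<dots> = (\<Sum>i\<in>insert j I. (k i * (\<phi> i s - \<phi> j s)) *s u i)"
        unfolding s.sum scale_sum_right sum_subtractf [symmetric]
        by (intro sum.cong refl)
           (use insert.prems(1) s in \<open>auto simp: s.scale scale_left_diff_distrib algebra_simps\<close>)
      also have "\<dots> = (\<Sum>i\<in>I. (k i * (\<phi> i s - \<phi> j s)) *s u i)"
        using insert.hyps by simp
      finally have "\<forall>i\<in>I. k i * (\<phi> i s - \<phi> j s) = 0"
        using IH unfolding independent_family_def by metis
      with i s show ?thesis by auto
    qed
    with k insert.hyps have "k j *s u j = 0" by simp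
    then show "\<forall>i\<in>insert j I. k i = 0" using kI insert.prems(2) by auto
  qed
qed

lemma independent_family_card_le:
  assumes ind: "independent_family I u" and "finite I" "finite B" and uB: "u ` I \<subseteq> span B"
  shows "card I \<le> card B"
proof -
  have inj: "inj_on u I"
  proof (rule inj_onI, rule ccontr)
    fix i j assume ij: "i \<in> I" "j \<in> I" "u i = u j" "i \<noteq> j"
    let ?k = "\<lambda>x. if x = i then 1 else if x = j then - 1 else (0::complex)"
    have "(\<Sum>x\<in>I. ?k x *s u x) = (\<Sum>x\<in>{i, j}. ?k x *s u x)"
      using ij \<open>finite I\<close> by (intro sum.mono_neutral_right) auto
    also have "\<dots> = 0" using ij by simp
    finally have "\<forall>x\<in>I. ?k x = 0"
      using ind unfolding independent_family_def by (elim allE[of _ ?k]) simp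
    with ij(1) show False by force
  qed
  have "independent (u ` I)"
  proof
    assume "dependent (u ` I)"
    then obtain k v where k: "v \<in> u ` I" "k v \<noteq> 0" "(\<Sum>v\<in>u ` I. k v *s v) = 0"
      using dependent_finite[of "u ` I"] \<open>finite I\<close> by blast
    then have "(\<Sum>i\<in>I. k (u i) *s u i) = 0" using inj by (simp add: sum.reindex)
    then have "\<forall>i\<in>I. k (u i) = 0" using ind by (auto simp: independent_family_def)
    with k show False by auto
  qed
  then have "card (u ` I) \<le> card B"
    using independent_span_bound[OF \<open>finite B\<close>] uB by blast
  then show ?thesis using inj by (simp add: card_image)
qed

end

section \<open>Alternating bicharacters on finite groups\<close>

context group
begin

text \<open>\<open>h \<otimes> inv (t i) \<in> A\<close> says that h and \<open>t i\<close> have the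
  same right coset. The cosets are numbered because they later index the rows of a matrix and the
  vectors of an orbit.\<close>

lemma subgroup_transversal:
  assumes fin: "finite (carrier G)" and A: "subgroup A G" and H: "subgroup H G" and AH: "A \<subseteq> H"
  shows "\<exists>N t. card H = N * card A \<and> (\<forall>i<N. t i \<in> H) \<and>
    (\<forall>h\<in>H. \<exists>!i. i < (N::nat) \<and> h \<otimes> inv (t i) \<in> A)"
proof -
  have Hc: "H \<subseteq> carrier G" and Ac: "A \<subseteq> carrier G"
    using A H by (auto dest: subgroup.subset)
  have finH: "finite H" using fin Hc finite_subset by blast
  define C where "C = (\<lambda>h. A #> h) ` H"
  have C_sub: "C \<subseteq> rcosets A" using Hc by (auto simp: C_def RCOSETS_def)
  have "\<Union>C = H"
  proof
    show "\<Union>C \<subseteq> H" using AH subgroup.m_closed[OF H] by (auto simp: C_def r_coset_def)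
    show "H \<subseteq> \<Union>C" using subgroup.one_closed[OF A] Hc by (force simp: C_def r_coset_def)
  qed
  moreover have "card A * card C = card (\<Union>C)"
  proof (rule card_partition)
    show "finite C" by (simp add: C_def finH)
    show "finite (\<Union>C)" using \<open>\<Union>C = H\<close> finH by simp
    show "card c = card A" if "c \<in> C" for c
      using card_rcosets_equal that C_sub Ac by fastforce
    show "c1 \<inter> c2 = {}" if "c1 \<in> C" "c2 \<in> C" "c1 \<noteq> c2" for c1 c2
      using rcos_disjoint[OF A] that C_sub by (auto simp: pairwise_def disjnt_def)
  qed
  ultimately have card: "card H = card C * card A" by (simp add: mult.commute)
  obtain f where f: "bij_betw f {..<card C} C"
    using ex_bij_betw_nat_finite[of C] finH by (auto simp: C_def atLeast0LessThan)
  define t where "t i = (SOME h. h \<in> H \<and> A #> h = f i)" for i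
  have t: "t i \<in> H \<and> A #> t i = f i" if "i < card C" for i
    unfolding t_def
  proof (rule someI_ex)
    have "f i \<in> C" using bij_betwE[OF f] that by simp
    then show "\<exists>h. h \<in> H \<and> A #> h = f i" by (auto simp: C_def)
  qed
  have coset: "h \<otimes> inv (t i) \<in> A \<longleftrightarrow> A #> h = f i" if "h \<in> H" "i < card C" for h i
  proof -
    have hc: "h \<in> carrier G" "t i \<in> carrier G" using that t Hc by auto
    show ?thesis
    proof
      assume "h \<otimes> inv (t i) \<in> A"
      then have "h \<in> A #> t i"
        using hc unfolding r_coset_def by (intro UN_I[of "h \<otimes> inv (t i)"]) (auto simp: m_assoc)
      then show "A #> h = f i" using repr_independence[OF _ hc(2) A] t that(2) by auto
    next
      assume "A #> h = f i"
      then have "h \<in> A #> t i" using rcos_self[OF hc(1) A] t that(2) by auto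
      then show "h \<otimes> inv (t i) \<in> A" using hc Ac by (auto simp: r_coset_def m_assoc)
    qed
  qed
  show ?thesis
  proof (intro exI conjI allI impI ballI)
    show "card H = card C * card A" by (rule card)
    show "t i \<in> H" if "i < card C" for i using t that by blast
    fix h assume h: "h \<in> H"
    then have "A #> h \<in> C" by (simp add: C_def)
    then obtain i where "i < card C" "f i = A #> h"
      using bij_betw_imp_surj_on[OF f] by (metis imageE lessThan_iff)
    then have "\<exists>!i. i < card C \<and> f i = A #> h"
      using bij_betw_imp_inj_on[OF f] by (intro ex1I[of _ i]) (auto simp: inj_on_def)
    then show "\<exists>!i. i < card C \<and> h \<otimes> inv (t i) \<in> A" using coset[OF h] by metis
  qed
qed

end

text \<open>The multiplicative counterpart of an alternating bilinear form. \<open>skew\<close>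
  excludes the value 0 and carries multiplicativity over to the right argument.\<close>

locale alternating_bicharacter = group G for G (structure) +
  fixes \<beta> :: "'a \<Rightarrow> 'a \<Rightarrow> complex"
  assumes finite_carrier: "finite (carrier G)"
    and mult_left: "\<lbrakk>x \<in> carrier G; y \<in> carrier G; w \<in> carrier G\<rbrakk> \<Longrightarrow> \<beta> (x \<otimes> y) w = \<beta> x w * \<beta> y w"
    and alternating: "x \<in> carrier G \<Longrightarrow> \<beta> x x = 1"
    and skew: "\<lbrakk>x \<in> carrier G; y \<in> carrier G\<rbrakk> \<Longrightarrow> \<beta> x y * \<beta> y x = 1"
begin

lemma nonzero: "\<lbrakk>x \<in> carrier G; y \<in> carrier G\<rbrakk> \<Longrightarrow> \<beta> x y \<noteq> 0"
  using skew[of x y] by auto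

lemma skew': "\<lbrakk>x \<in> carrier G; y \<in> carrier G\<rbrakk> \<Longrightarrow> \<beta> y x = inverse (\<beta> x y)"
  using skew[of x y] by (simp add: inverse_unique)

lemma mult_right:
  "\<lbrakk>x \<in> carrier G; y \<in> carrier G; w \<in> carrier G\<rbrakk> \<Longrightarrow> \<beta> w (x \<otimes> y) = \<beta> w x * \<beta> w y"
  using skew'[of "x \<otimes> y" w] skew'[of x w] skew'[of y w] mult_left by simp

lemma one_left [simp]: "x \<in> carrier G \<Longrightarrow> \<beta> \<one> x = 1"
  using mult_left[of \<one> \<one> x] nonzero[of \<one> x] by simp

lemma one_right [simp]: "x \<in> carrier G \<Longrightarrow> \<beta> x \<one> = 1"
  using skew'[of \<one> x] by simp

lemma inv_left: "\<lbrakk>x \<in> carrier G; y \<in> carrier G\<rbrakk> \<Longrightarrow> \<beta> (inv x) y = inverse (\<beta> x y)"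
  using mult_left[of x "inv x" y] by (simp add: inverse_unique)

lemma inv_right: "\<lbrakk>x \<in> carrier G; y \<in> carrier G\<rbrakk> \<Longrightarrow> \<beta> x (inv y) = inverse (\<beta> x y)"
  using mult_right[of y "inv y" x] by (simp add: inverse_unique)

lemma pow_left: "\<lbrakk>x \<in> carrier G; y \<in> carrier G\<rbrakk> \<Longrightarrow> \<beta> (x [^] (k::nat)) y = \<beta> x y ^ k"
  by (induction k) (auto simp: mult_left)

lemma eq_1_commute: "\<lbrakk>x \<in> carrier G; y \<in> carrier G\<rbrakk> \<Longrightarrow> \<beta> x y = 1 \<longleftrightarrow> \<beta> y x = 1"
  using skew[of x y] by auto

definition perp :: "'a set \<Rightarrow> 'a set" where
  "perp H = {g \<in> carrier G. \<forall>h\<in>H. \<beta> g h = 1}"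

lemma subgroup_perp: "H \<subseteq> carrier G \<Longrightarrow> subgroup (perp H) G"
  by (rule subgroup.intro) (auto simp: perp_def mult_left inv_left subset_iff)

lemma perp_symmetric: "\<lbrakk>g \<in> perp H; h \<in> H; H \<subseteq> carrier G\<rbrakk> \<Longrightarrow> \<beta> h g = 1"
  using eq_1_commute by (auto simp: perp_def)

lemma sum_character:
  assumes H: "subgroup H G" and x: "x \<in> carrier G"
  shows "(\<Sum>h\<in>H. \<beta> h x) = (if x \<in> perp H then of_nat (card H) else 0)"
proof -
  have Hc: "H \<subseteq> carrier G" using H by (rule subgroup.subset)
  have mem: "x \<in> perp H \<longleftrightarrow> (\<forall>h\<in>H. \<beta> h x = 1)"
    using eq_1_commute Hc x by (auto simp: perp_def)
  show ?thesis
  proof (cases "x \<in> perp H")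
    case False
    then obtain h0 where h0: "h0 \<in> H" "\<beta> h0 x \<noteq> 1" using mem by auto
    \<comment> \<open>Translation by h0 permutes H and multiplies the sum by a number other than 1,
      so the sum is 0.\<close>
    have "bij_betw (\<lambda>h. h0 \<otimes> h) H H"
    proof (rule bij_betw_byWitness [where f' = "\<lambda>h. inv h0 \<otimes> h"])
      show "\<forall>a\<in>H. inv h0 \<otimes> (h0 \<otimes> a) = a" "\<forall>a\<in>H. h0 \<otimes> (inv h0 \<otimes> a) = a"
        using Hc h0 by (auto simp: m_assoc[symmetric] subset_iff)
      show "(\<otimes>) h0 ` H \<subseteq> H" "(\<otimes>) (inv h0) ` H \<subseteq> H"
        using H h0 by (auto simp: subgroup.m_closed subgroup.m_inv_closed)
    qed
    then have "(\<Sum>h\<in>H. \<beta> h x) = (\<Sum>h\<in>H. \<beta> (h0 \<otimes> h) x)"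
      by (rule sum.reindex_bij_betw [symmetric])
    also have "\<dots> = \<beta> h0 x * (\<Sum>h\<in>H. \<beta> h x)"
      unfolding sum_distrib_left using Hc h0 x by (intro sum.cong refl mult_left) auto
    finally show ?thesis using h0 False by simp
  next
    case True
    then have "(\<Sum>h\<in>H. \<beta> h x) = (\<Sum>h\<in>H. 1)" using mem by (intro sum.cong) auto
    then show ?thesis using True by simp
  qed
qed

text \<open>Both sides count \<open>\<Sum>\<^bsub>a\<in>A, b\<in>B\<^esub> \<beta> a b\<close>.\<close>

lemma card_perp_symmetric:
  assumes A: "subgroup A G" and B: "subgroup B G"
  shows "card B * card (A \<inter> perp B) = card A * card (B \<inter> perp A)"
proof -
  have Ac: "A \<subseteq> carrier G" "B \<subseteq> carrier G" using A B by (auto dest: subgroup.subset)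
  then have fin: "finite A" "finite B" using finite_carrier finite_subset by blast+
  have "of_nat (card A * card (B \<inter> perp A)) = (\<Sum>b\<in>B. \<Sum>a\<in>A. \<beta> a b)"
    using Ac fin by (simp add: sum_character[OF A] subset_iff sum.If_cases Int_def)
  \<comment> \<open>Exchanging the arguments inverts the value, which is the same as inverting b;
    inversion permutes B, so both orders of the arguments give the same double sum.\<close>
  also have "\<dots> = (\<Sum>a\<in>A. \<Sum>b\<in>B. inverse (\<beta> b a))"
    using Ac by (subst sum.swap, intro sum.cong refl skew') auto
  also have "\<dots> = (\<Sum>a\<in>A. \<Sum>b\<in>B. \<beta> (inv b) a)"
    using Ac by (intro sum.cong refl inv_left [symmetric]) auto
  also have "\<dots> = (\<Sum>a\<in>A. \<Sum>b\<in>B. \<beta> b a)"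
  proof (rule sum.cong [OF refl])
    fix a assume "a \<in> A"
    have "bij_betw (m_inv G) B B"
      by (rule bij_betw_byWitness [where f' = "m_inv G"])
         (use Ac B in \<open>auto simp: subgroup.m_inv_closed subset_iff\<close>)
    then show "(\<Sum>b\<in>B. \<beta> (inv b) a) = (\<Sum>b\<in>B. \<beta> b a)"
      by (rule sum.reindex_bij_betw)
  qed
  also have "\<dots> = of_nat (card B * card (A \<inter> perp B))"
    using Ac fin by (simp add: sum_character[OF B] subset_iff sum.If_cases Int_def)
  finally show ?thesis using of_nat_eq_iff by metis
qed

definition isotropic :: "'a set \<Rightarrow> bool" where
  "isotropic A \<longleftrightarrow> (\<forall>a\<in>A. \<forall>b\<in>A. \<beta> a b = 1)"

text \<open>Isotropy puts A inside \<open>perp A\<close>, and counting A against the whole group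
  expresses \<open>|A| |perp A|\<close> as |G| times the part of A in the radical.\<close>

lemma isotropic_card_le:
  assumes A: "subgroup A G" "isotropic A"
  shows "card A ^ 2 \<le> card (carrier G) * card (perp (carrier G))"
proof -
  have Ac: "A \<subseteq> carrier G" using A by (auto dest: subgroup.subset)
  have "A \<subseteq> perp A" using A Ac by (auto simp: perp_def isotropic_def)
  then have "card A * card A \<le> card A * card (carrier G \<inter> perp A)"
    using Ac finite_carrier by (intro mult_le_mono2 card_mono) auto
  also have "\<dots> = card (carrier G) * card (A \<inter> perp (carrier G))"
    using card_perp_symmetric[OF A(1) subgroup_self] by simp
  also have "\<dots> \<le> card (carrier G) * card (perp (carrier G))"
    using finite_carrier by (intro mult_le_mono2 card_mono) (auto simp: perp_def)
  finally show ?thesis by (simp add: power2_eq_square)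
qed

text \<open>A maximal isotropic \<^emph>\<open>subset\<close> equals its own orthogonal complement, hence is a subgroup.\<close>

lemma lagrangian_exists:
  assumes H: "subgroup H G"
  obtains A where "subgroup A G" "A \<subseteq> H" "isotropic A" "H \<inter> perp A = A"
    "card A ^ 2 = card H * card (H \<inter> perp H)"
proof -
  have Hc: "H \<subseteq> carrier G" using H by (rule subgroup.subset)
  then have finH: "finite H" using finite_carrier finite_subset by blast
  define F where "F = {A. A \<subseteq> H \<and> isotropic A}"
  have "finite F" using finH by (auto simp: F_def)
  moreover have "{} \<in> F" by (simp add: F_def isotropic_def)
  ultimately obtain A where A: "A \<in> F" and max: "\<And>B. B \<in> F \<Longrightarrow> A \<subseteq> B \<Longrightarrow> A = B"
    using finite_has_maximal[of F] by blast
  have AH: "A \<subseteq> H" and iso: "isotropic A" using A by (auto simp: F_def)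
  have perpA: "H \<inter> perp A = A"
  proof
    show "A \<subseteq> H \<inter> perp A" using AH Hc iso by (auto simp: perp_def isotropic_def)
    show "H \<inter> perp A \<subseteq> A"
    proof
      \<comment> \<open>Adding g keeps A isotropic because \<open>\<beta> g g = 1\<close>;
        maximality then puts g into A.\<close>
      fix g assume g: "g \<in> H \<inter> perp A"
      then have "insert g A \<in> F"
        using AH iso Hc alternating eq_1_commute
        by (auto simp: F_def isotropic_def perp_def subset_iff)
      then show "g \<in> A" using max by blast
    qed
  qed
  have sub: "subgroup A G"
    using subgroups_Inter_pair[OF H subgroup_perp] AH Hc perpA by (metis subset_trans)
  \<comment> \<open>The radical of H is orthogonal to A, hence contained in A; this is what fixes
    the order of A in the count.\<close>
  have "A \<inter> perp H = H \<inter> perp H"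
  proof
    show "H \<inter> perp H \<subseteq> A \<inter> perp H"
      using AH perpA by (auto simp: perp_def)
  qed (use AH in auto)
  then have "card A ^ 2 = card H * card (H \<inter> perp H)"
    using card_perp_symmetric[OF sub H] perpA by (simp add: power2_eq_square)
  then show thesis using that sub AH iso perpA by blast
qed

end

section \<open>Characters of abelian subgroups\<close>

text \<open>Serves for functions on the group, whose translations yield characters, and for
  functions on indices, on which matrices act.\<close>

interpretation fun_space: complex_vector_space "\<lambda>(c::complex) (f::'i \<Rightarrow> complex) x. c * f x"
  by unfold_locales (auto simp: fun_eq_iff algebra_simps)

context group
begin

text \<open>Characters arise as eigenvalues: translations by the abelian A commute, and the |G|-th
  power of each is the identity on W, so they have a common eigenvector. The functions are defined
  on the whole type, hence the cut-off to 0 outside A.\<close>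

lemma translation_eigenfunction:
  fixes W :: "('a \<Rightarrow> complex) set"
  assumes fin: "finite (carrier G)" and A: "subgroup A G"
    and comm: "\<And>a b. a \<in> A \<Longrightarrow> b \<in> A \<Longrightarrow> a \<otimes> b = b \<otimes> a"
    and W: "fun_space.subspace W"
    and inv: "\<And>a f. a \<in> A \<Longrightarrow> f \<in> W \<Longrightarrow> (\<lambda>x. if x \<in> A then f (x \<otimes> a) else 0) \<in> W"
    and supp: "\<And>f x. f \<in> W \<Longrightarrow> x \<notin> A \<Longrightarrow> f x = 0"
    and f0: "f0 \<in> W" "f0 \<noteq> 0"
  shows "\<exists>f\<in>W. f \<noteq> 0 \<and> (\<exists>\<psi>. (\<forall>a\<in>A. \<psi> a \<noteq> 0) \<and>
    (\<forall>a\<in>A. \<forall>b\<in>A. \<psi> (a \<otimes> b) = \<psi> a * \<psi> b) \<and> (\<forall>a\<in>A. \<forall>x\<in>A. f (x \<otimes> a) = \<psi> a * f x))"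
proof -
  have Ac: "A \<subseteq> carrier G" using A by (rule subgroup.subset)
  note cl = subgroup.m_closed[OF A] subgroup.one_closed[OF A] subgroup.m_inv_closed[OF A]
  define T where "T a f = (\<lambda>x. if x \<in> A then f (x \<otimes> a) else 0)" for a and f :: "'a \<Rightarrow> complex"
  have lin: "Vector_Spaces.linear (\<lambda>(c::complex) f x. c * f x) (\<lambda>c f x. c * f x) (T a)" for a
    by unfold_locales (auto simp: T_def fun_eq_iff)
  have pow: "(T a ^^ k) f = T (a [^] k) f" if "a \<in> A" "f \<in> W" for a f and k :: nat
  proof (induction k)
    case 0
    show ?case using supp[OF that(2)] Ac by (auto simp: T_def fun_eq_iff)
  next
    case (Suc k)
    have "a [^] k \<in> A" for k :: nat using that(1) by (induction k) (auto simp: cl)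
    then have "x \<otimes> a \<otimes> a [^] k = x \<otimes> (a [^] k \<otimes> a)" if "x \<in> A" for x
      using comm[of a "a [^] k"] \<open>a \<in> A\<close> that Ac by (simp add: m_assoc subset_iff)
    then show ?case using Suc that by (auto simp: T_def fun_eq_iff cl)
  qed
  have "\<exists>v\<in>W. v \<noteq> 0 \<and> (\<exists>\<psi>. \<forall>s\<in>A. T s v = (\<lambda>x. \<psi> s * v x))"
  proof (rule fun_space.common_eigenvector[OF _ W f0])
    show "finite A" using fin Ac finite_subset by blast
    show "Vector_Spaces.linear (\<lambda>(c::complex) f x. c * f x) (\<lambda>c f x. c * f x) (T a)" for a
      by (rule lin)
    show "T s ` W \<subseteq> W" if "s \<in> A" for s using inv[OF that] by (auto simp: T_def)
    show "T s (T t v) = T t (T s v)" if "s \<in> A" "t \<in> A" for s t v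
    proof -
      have "x \<otimes> s \<otimes> t = x \<otimes> t \<otimes> s" if "x \<in> A" for x
        using comm[of s t] \<open>s \<in> A\<close> \<open>t \<in> A\<close> that Ac by (simp add: m_assoc subset_iff)
      then show ?thesis using that by (auto simp: T_def fun_eq_iff cl)
    qed
    show "\<exists>N>0. \<exists>c\<noteq>0. (T s ^^ N) v = (\<lambda>x. c * v x)" if "s \<in> A" "v \<in> W" for s v
    proof (intro exI conjI)
      show "card (carrier G) > 0" using fin by (auto simp: card_gt_0_iff)
      show "(T s ^^ card (carrier G)) v = (\<lambda>x. 1 * v x)"
        using pow[OF that] pow_order_eq_1[OF subsetD[OF Ac that(1)], unfolded Coset.order_def]
          supp[OF that(2)] that Ac by (auto simp: T_def fun_eq_iff)
    qed simp
  qed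
  then obtain f \<psi> where f: "f \<in> W" "f \<noteq> 0" "\<And>a. a \<in> A \<Longrightarrow> T a f = (\<lambda>x. \<psi> a * f x)" by blast
  have eig: "f (x \<otimes> a) = \<psi> a * f x" if "a \<in> A" "x \<in> A" for a x
    using fun_cong[OF f(3)[OF that(1)], of x] that by (simp add: T_def)
  obtain x where x: "x \<in> A" "f x \<noteq> 0" using supp f(1,2) by (auto simp: fun_eq_iff)
  have mult: "\<psi> (a \<otimes> b) = \<psi> a * \<psi> b" if "a \<in> A" "b \<in> A" for a b
  proof -
    have "\<psi> (a \<otimes> b) * f x = f (x \<otimes> a \<otimes> b)"
      using eig[of "a \<otimes> b" x] that x Ac by (simp add: cl m_assoc subset_iff)
    also have "\<dots> = \<psi> b * (\<psi> a * f x)" using eig that x by (simp add: cl)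
    finally show ?thesis using x by simp
  qed
  have "\<psi> a \<noteq> 0" if "a \<in> A" for a
  proof
    assume "\<psi> a = 0"
    then have "f (x \<otimes> inv a \<otimes> a) = 0" using eig[OF that, of "x \<otimes> inv a"] that x by (simp add: cl)
    then show False using that x Ac by (simp add: m_assoc subset_iff)
  qed
  then show ?thesis using f(1,2) eig mult by (intro bexI[of _ f] conjI exI[of _ \<psi>]) auto
qed

text \<open>The functions on A that transform under Z by \<chi> form a translation-invariant space,
  nonzero because it contains \<chi> extended by zero. An eigenfunction f in it satisfies both
  \<open>f (z \<otimes> x) = \<psi> z * f x\<close> and
  \<open>f (z \<otimes> x) = \<chi> z * f x\<close>.\<close>

lemma character_extension:
  assumes fin: "finite (carrier G)" and A: "subgroup A G"
    and comm: "\<And>a b. a \<in> A \<Longrightarrow> b \<in> A \<Longrightarrow> a \<otimes> b = b \<otimes> a"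
    and Z: "subgroup Z G" "Z \<subseteq> A"
    and chi: "\<And>a b. a \<in> Z \<Longrightarrow> b \<in> Z \<Longrightarrow> \<chi> (a \<otimes> b) = \<chi> a * (\<chi> b :: complex)"
      "\<And>a. a \<in> Z \<Longrightarrow> \<chi> a \<noteq> 0"
  shows "\<exists>\<psi> :: 'a \<Rightarrow> complex. (\<forall>a\<in>A. \<forall>b\<in>A. \<psi> (a \<otimes> b) = \<psi> a * \<psi> b) \<and>
    (\<forall>a\<in>A. \<psi> a \<noteq> 0) \<and> (\<forall>z\<in>Z. \<psi> z = \<chi> z)"
proof -
  have Ac: "A \<subseteq> carrier G" using A by (rule subgroup.subset)
  note cl = subgroup.m_closed[OF A] subgroup.one_closed[OF A] subgroup.m_inv_closed[OF A]
    subgroup.m_closed[OF Z(1)] subgroup.one_closed[OF Z(1)] subgroup.m_inv_closed[OF Z(1)]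
  define W where "W = {f. (\<forall>x. x \<notin> A \<longrightarrow> f x = (0::complex)) \<and> (\<forall>z\<in>Z. \<forall>a\<in>A. f (z \<otimes> a) = \<chi> z * f a)}"
  have sub: "fun_space.subspace W"
    by (auto simp: fun_space.subspace_def W_def algebra_simps)
  let ?f0 = "\<lambda>x. if x \<in> Z then \<chi> x else 0"
  have in_Z: "z \<otimes> a \<in> Z \<longleftrightarrow> a \<in> Z" if "z \<in> Z" "a \<in> A" for z a
  proof
    assume "z \<otimes> a \<in> Z"
    then have "inv z \<otimes> (z \<otimes> a) \<in> Z" using that by (simp add: cl)
    then show "a \<in> Z" using that Z Ac by (simp add: m_assoc [symmetric] subset_iff)
  qed (use that cl in auto)
  have f0: "?f0 \<in> W" using Z(2) in_Z by (auto simp: W_def chi)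
  have "?f0 \<noteq> 0" using chi(2)[of \<one>] cl by (auto simp: fun_eq_iff)
  have "\<exists>f\<in>W. f \<noteq> 0 \<and> (\<exists>\<psi>. (\<forall>a\<in>A. \<psi> a \<noteq> 0) \<and>
    (\<forall>a\<in>A. \<forall>b\<in>A. \<psi> (a \<otimes> b) = \<psi> a * \<psi> b) \<and> (\<forall>a\<in>A. \<forall>x\<in>A. f (x \<otimes> a) = \<psi> a * f x))"
  proof (rule translation_eigenfunction[OF fin A _ sub _ _ f0 \<open>?f0 \<noteq> 0\<close>])
    show "a \<otimes> b = b \<otimes> a" if "a \<in> A" "b \<in> A" for a b using comm that by blast
    show "(\<lambda>x. if x \<in> A then f (x \<otimes> a) else 0) \<in> W" if a: "a \<in> A" "f \<in> W" for a f
    proof -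
      have "f (z \<otimes> b \<otimes> a) = \<chi> z * f (b \<otimes> a)" if "z \<in> Z" "b \<in> A" for z b
        using a that Z Ac by (auto simp: m_assoc subset_iff W_def cl)
      then show ?thesis using a Z(2) by (auto simp: W_def cl)
    qed
    show "f x = 0" if "f \<in> W" "x \<notin> A" for f x using that by (auto simp: W_def)
  qed
  then obtain f \<psi> where f: "f \<in> W" "f \<noteq> 0"
    and eig: "\<And>a x. a \<in> A \<Longrightarrow> x \<in> A \<Longrightarrow> f (x \<otimes> a) = \<psi> a * f x"
    and mult: "\<And>a b. a \<in> A \<Longrightarrow> b \<in> A \<Longrightarrow> \<psi> (a \<otimes> b) = \<psi> a * \<psi> b"
    and nz: "\<And>a. a \<in> A \<Longrightarrow> \<psi> a \<noteq> 0"
    by blast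
  obtain x where x: "x \<in> A" "f x \<noteq> 0" using f by (auto simp: W_def fun_eq_iff)
  have "\<psi> z = \<chi> z" if z: "z \<in> Z" for z
  proof -
    have "\<psi> z * f x = f (z \<otimes> x)" using eig[of z x] comm[of x z] z x Z(2) by auto
    also have "\<dots> = \<chi> z * f x" using f z x by (auto simp: W_def)
    finally show ?thesis using x by simp
  qed
  then show ?thesis using mult nz by blast
qed

text \<open>By Lagrange, \<open>K \<inter> Z\<close> has order 1 or the prime. In the applications K
  collects the elements with some property, and one nontrivial element of Z brings in all of
  Z.\<close>

lemma prime_order_subgroup:
  assumes Z: "subgroup Z G" "Factorial_Ring.prime (card Z)" and K: "subgroup K G"
    and x: "x \<in> Z" "x \<in> K" "x \<noteq> \<one>"
  shows "Z \<subseteq> K"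
proof -
  have finZ: "finite Z" using Z(2) by (metis card.infinite not_prime_0)
  have KZ: "subgroup (K \<inter> Z) G" using subgroups_Inter_pair K Z by blast
  interpret Zg: group "G\<lparr>carrier := Z\<rparr>" using subgroup_imp_group Z by blast
  have "subgroup (K \<inter> Z) (G\<lparr>carrier := Z\<rparr>)" using subgroup_incl KZ Z by blast
  from Zg.lagrange[OF this] have "card Z = card (rcosets\<^bsub>G\<lparr>carrier := Z\<rparr>\<^esub> (K \<inter> Z)) * card (K \<inter> Z)"
    by (simp add: Coset.order_def)
  then have "card (K \<inter> Z) dvd card Z" by (metis dvd_triv_right)
  moreover have "card {\<one>, x} \<le> card (K \<inter> Z)"
    using x finZ subgroup.one_closed[OF KZ] by (intro card_mono) auto
  then have "card (K \<inter> Z) \<noteq> 1" using x by auto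
  ultimately have "card (K \<inter> Z) = card Z" using Z(2) by (metis prime_nat_iff)
  then have "K \<inter> Z = Z" using finZ by (intro card_subset_eq) auto
  then show ?thesis by blast
qed

text \<open>The trivial character must be avoided. Its eigenfunctions are constant, and a constant
  function with sum 0 on Z vanishes; so an eigenfunction among the sum-zero functions has a
  nontrivial character, whose kernel is trivial because |Z| is prime.\<close>

lemma prime_order_character:
  assumes fin: "finite (carrier G)" and Z: "subgroup Z G" "Factorial_Ring.prime (card Z)"
    and comm: "\<And>a b. a \<in> Z \<Longrightarrow> b \<in> Z \<Longrightarrow> a \<otimes> b = b \<otimes> a"
  obtains \<chi> :: "'a \<Rightarrow> complex"
  where "\<And>a b. a \<in> Z \<Longrightarrow> b \<in> Z \<Longrightarrow> \<chi> (a \<otimes> b) = \<chi> a * \<chi> b"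
    and "\<And>a. a \<in> Z \<Longrightarrow> \<chi> a \<noteq> 0" and "\<And>z. z \<in> Z \<Longrightarrow> \<chi> z = 1 \<Longrightarrow> z = \<one>"
proof -
  have Zc: "Z \<subseteq> carrier G" using Z(1) by (rule subgroup.subset)
  have finZ: "finite Z" using Zc fin finite_subset by blast
  note cl = subgroup.m_closed[OF Z(1)] subgroup.one_closed[OF Z(1)] subgroup.m_inv_closed[OF Z(1)]
  have "1 < card Z" using Z(2) by (rule prime_gt_1_nat)
  then have "\<not> Z \<subseteq> {\<one>}" using card_mono[of "{\<one>}" Z] by auto
  then obtain z where z: "z \<in> Z" "z \<noteq> \<one>" by blast
  define W where "W = {f. (\<forall>x. x \<notin> Z \<longrightarrow> f x = (0::complex)) \<and> sum f Z = 0}"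
  have sub: "fun_space.subspace W"
    by (auto simp: fun_space.subspace_def W_def sum.distrib sum_distrib_left [symmetric])
  let ?f0 = "\<lambda>x. if x = \<one> then 1 else if x = z then -1 else (0::complex)"
  have "sum ?f0 Z = sum ?f0 {\<one>, z}"
    using z finZ cl by (intro sum.mono_neutral_right) auto
  then have f0: "?f0 \<in> W" using z cl by (auto simp: W_def)
  have "?f0 \<noteq> 0" by (auto dest: fun_cong[of _ _ \<one>])
  have "\<exists>f\<in>W. f \<noteq> 0 \<and> (\<exists>\<psi>. (\<forall>a\<in>Z. \<psi> a \<noteq> 0) \<and>
    (\<forall>a\<in>Z. \<forall>b\<in>Z. \<psi> (a \<otimes> b) = \<psi> a * \<psi> b) \<and> (\<forall>a\<in>Z. \<forall>x\<in>Z. f (x \<otimes> a) = \<psi> a * f x))"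
  proof (rule translation_eigenfunction[OF fin Z(1) _ sub _ _ f0 \<open>?f0 \<noteq> 0\<close>])
    show "a \<otimes> b = b \<otimes> a" if "a \<in> Z" "b \<in> Z" for a b using comm that by blast
    show "(\<lambda>x. if x \<in> Z then f (x \<otimes> a) else 0) \<in> W" if a: "a \<in> Z" "f \<in> W" for a f
    proof -
      have "bij_betw (\<lambda>x. x \<otimes> a) Z Z"
        by (rule bij_betw_byWitness [where f' = "\<lambda>x. x \<otimes> inv a"])
           (use Zc a in \<open>auto simp: cl m_assoc subset_iff\<close>)
      then have "(\<Sum>x\<in>Z. f (x \<otimes> a)) = sum f Z" by (rule sum.reindex_bij_betw)
      then show ?thesis using a by (auto simp: W_def)
    qed
    show "f x = 0" if "f \<in> W" "x \<notin> Z" for f x using that by (auto simp: W_def)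
  qed
  then obtain f \<psi> where f: "f \<in> W" "f \<noteq> 0"
    and eig: "\<And>a x. a \<in> Z \<Longrightarrow> x \<in> Z \<Longrightarrow> f (x \<otimes> a) = \<psi> a * f x"
    and mult: "\<And>a b. a \<in> Z \<Longrightarrow> b \<in> Z \<Longrightarrow> \<psi> (a \<otimes> b) = \<psi> a * \<psi> b"
    and nz: "\<And>a. a \<in> Z \<Longrightarrow> \<psi> a \<noteq> 0"
    by blast
  have one: "\<psi> \<one> = 1" using mult[of \<one> \<one>] nz[of \<one>] cl by simp
  define K where "K = {x \<in> Z. \<psi> x = 1}"
  have K: "subgroup K G"
  proof (rule subgroup.intro)
    show "inv x \<in> K" if "x \<in> K" for x
      using mult[of x "inv x"] that Zc one by (auto simp: K_def cl subset_iff)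
  qed (use Zc one mult cl in \<open>auto simp: K_def\<close>)
  have "x = \<one>" if x: "x \<in> Z" "\<psi> x = 1" for x
  proof (rule ccontr)
    assume "x \<noteq> \<one>"
    then have "Z \<subseteq> K" using prime_order_subgroup[OF Z K] x by (auto simp: K_def)
    then have const: "f a = f \<one>" if "a \<in> Z" for a
      using eig[of a \<one>] that subsetD[OF Zc that] cl by (auto simp: K_def)
    then have "sum f Z = of_nat (card Z) * f \<one>" by simp
    moreover have "card Z \<noteq> 0" using \<open>1 < card Z\<close> by simp
    ultimately have "f \<one> = 0" using f by (auto simp: W_def)
    then have "f = 0" using const f by (auto simp: W_def fun_eq_iff)
    with f show False by simp
  qed
  then show thesis using that mult nz by blast
qed

end

section \<open>Extra-special groups\<close>

locale extra_special_group = group G for G (structure) +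
  fixes p :: nat
  assumes extra_special: "extra_special p G"
begin

abbreviation Z :: "'a set" where "Z \<equiv> group_center G"

definition comm :: "'a \<Rightarrow> 'a \<Rightarrow> 'a" where "comm g h = g \<otimes> h \<otimes> inv g \<otimes> inv h"

lemma finite_G: "finite (carrier G)" and prime_p: "Factorial_Ring.prime p" and card_Z: "card Z = p"
  using extra_special by (auto simp: extra_special_def)

lemma Z_closed: "z \<in> Z \<Longrightarrow> z \<in> carrier G"
  by (simp add: group_center_def)

lemma Z_commute: "z \<in> Z \<Longrightarrow> x \<in> carrier G \<Longrightarrow> z \<otimes> x = x \<otimes> z"
  by (simp add: group_center_def)

lemma comm_in_Z: "g \<in> carrier G \<Longrightarrow> h \<in> carrier G \<Longrightarrow> comm g h \<in> Z"
proof -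
  assume gh: "g \<in> carrier G" "h \<in> carrier G"
  have "Z = generate G (derived_set G (carrier G))"
    using extra_special by (simp add: extra_special_def derived_def)
  with gh show ?thesis unfolding comm_def by (auto intro!: generate.incl)
qed

lemma subgroup_Z: "subgroup Z G"
proof -
  have "Z = derived G (carrier G)"
    using extra_special by (simp add: extra_special_def)
  then show ?thesis using derived_is_subgroup[of "carrier G"] by simp
qed

lemma comm_closed: "g \<in> carrier G \<Longrightarrow> h \<in> carrier G \<Longrightarrow> comm g h \<in> carrier G"
  by (simp add: comm_def)

lemma comm_mult: "g \<in> carrier G \<Longrightarrow> h \<in> carrier G \<Longrightarrow> g \<otimes> h = comm g h \<otimes> (h \<otimes> g)"
  by (simp add: comm_def m_assoc) (simp add: m_assoc [symmetric])

lemma comm_eq_one: "g \<in> carrier G \<Longrightarrow> h \<in> carrier G \<Longrightarrow> comm g h = \<one> \<longleftrightarrow> g \<otimes> h = h \<otimes> g"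
  using comm_mult[of g h] comm_closed[of g h] r_cancel_one'[of "h \<otimes> g" "comm g h"] by force

text \<open>Commutators are central, so \<open>comm y w\<close> can be pulled out of the conjugation
  by x. This is what makes the commutator pairing a bicharacter.\<close>

lemma comm_mult_left:
  assumes "x \<in> carrier G" "y \<in> carrier G" "w \<in> carrier G"
  shows "comm (x \<otimes> y) w = comm x w \<otimes> comm y w"
proof -
  have cancel: "inv w \<otimes> (w \<otimes> u) = u" if "u \<in> carrier G" for u
    using assms that by (simp flip: m_assoc)
  have "comm (x \<otimes> y) w = x \<otimes> (comm y w \<otimes> (w \<otimes> (inv x \<otimes> inv w)))"
    using assms by (simp add: comm_def m_assoc inv_mult_group cancel)
  also have "\<dots> = comm y w \<otimes> (x \<otimes> (w \<otimes> (inv x \<otimes> inv w)))"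
    using Z_commute[OF comm_in_Z, of y w x] assms comm_closed[of y w] by (simp flip: m_assoc)
  also have "\<dots> = comm y w \<otimes> comm x w"
    using assms by (simp add: comm_def m_assoc)
  also have "\<dots> = comm x w \<otimes> comm y w"
    using Z_commute[OF comm_in_Z, of y w "comm x w"] assms comm_closed by simp
  finally show ?thesis .
qed

lemma comm_skew: "x \<in> carrier G \<Longrightarrow> y \<in> carrier G \<Longrightarrow> comm x y \<otimes> comm y x = \<one>"
  by (simp add: comm_def m_assoc) (simp add: m_assoc [symmetric])

lemma Z_subset_subgroup: "\<lbrakk>subgroup K G; x \<in> Z; x \<in> K; x \<noteq> \<one>\<rbrakk> \<Longrightarrow> Z \<subseteq> K"
  using prime_order_subgroup[OF subgroup_Z] card_Z prime_p by simp

lemma Z_nontrivial: obtains z where "z \<in> Z" "z \<noteq> \<one>"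
proof -
  have "\<not> Z \<subseteq> {\<one>}" using card_mono[of "{\<one>}" Z] card_Z prime_gt_1_nat[OF prime_p] by auto
  then show thesis using that by blast
qed

lemma Z_powers:
  assumes c: "c \<in> Z" "c \<noteq> \<one>"
  shows "bij_betw (\<lambda>i::nat. c [^] i) {..<p} Z"
proof -
  have cG: "c \<in> carrier G" using c by (simp add: Z_closed)
  have "generate G {c} \<subseteq> Z" using generate_subgroup_incl[of "{c}" Z] c subgroup_Z by auto
  moreover have "Z \<subseteq> generate G {c}"
    using generate_is_subgroup[of "{c}"] cG c by (intro Z_subset_subgroup) (auto intro: generate.incl)
  ultimately have gen: "generate G {c} = Z" by blast
  then have "ord c = p" using generate_pow_card[OF cG] card_Z by simp
  then have inj: "inj_on (\<lambda>i::nat. c [^] i) {..<p}"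
    using ord_inj[OF cG] prime_gt_0_nat[OF prime_p] unfolding inj_on_def by fastforce
  have "c [^] (i::nat) \<in> Z" for i
    by (induction i) (use c subgroup_Z in \<open>auto simp: subgroup.m_closed subgroup.one_closed\<close>)
  then have "(\<lambda>i::nat. c [^] i) ` {..<p} = Z"
    using inj card_Z prime_gt_0_nat[OF prime_p]
    by (intro card_subset_eq) (auto simp: card_image intro: card_ge_0_finite)
  with inj show ?thesis by (simp add: bij_betw_def)
qed

end

section \<open>The commutator pairing and its orthogonal geometry\<close>

locale extra_special_character = extra_special_group +
  fixes \<chi> :: "'a \<Rightarrow> complex"
  assumes chi_mult: "\<lbrakk>a \<in> Z; b \<in> Z\<rbrakk> \<Longrightarrow> \<chi> (a \<otimes> b) = \<chi> a * \<chi> b"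
    and chi_nonzero: "a \<in> Z \<Longrightarrow> \<chi> a \<noteq> 0"
    and chi_faithful: "\<lbrakk>a \<in> Z; \<chi> a = 1\<rbrakk> \<Longrightarrow> a = \<one>"
begin

lemma chi_one: "\<chi> \<one> = 1"
  using chi_mult[of \<one> \<one>] chi_nonzero[of \<one>] subgroup.one_closed[OF subgroup_Z] by simp

abbreviation \<beta> :: "'a \<Rightarrow> 'a \<Rightarrow> complex" where "\<beta> g h \<equiv> \<chi> (comm g h)"

sublocale alternating_bicharacter G \<beta>
proof unfold_locales
  show "\<beta> (x \<otimes> y) w = \<beta> x w * \<beta> y w" if "x \<in> carrier G" "y \<in> carrier G" "w \<in> carrier G" for x y w
    using that by (simp add: comm_mult_left chi_mult comm_in_Z)
  show "\<beta> x x = 1" if "x \<in> carrier G" for x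
    using comm_eq_one[of x x] that by (simp add: chi_one)
  show "\<beta> x y * \<beta> y x = 1" if "x \<in> carrier G" "y \<in> carrier G" for x y
    using comm_skew[OF that] chi_mult[of "comm x y" "comm y x"] that by (simp add: comm_in_Z chi_one)
qed (rule finite_G)

lemma bichar_eq_1: "\<lbrakk>x \<in> carrier G; y \<in> carrier G\<rbrakk> \<Longrightarrow> \<beta> x y = 1 \<longleftrightarrow> x \<otimes> y = y \<otimes> x"
  using comm_eq_one chi_faithful[OF comm_in_Z] chi_one by metis

lemma perp_carrier: "perp (carrier G) = Z"
  by (auto simp: perp_def group_center_def bichar_eq_1)

lemma Z_perp: "H \<subseteq> carrier G \<Longrightarrow> Z \<subseteq> perp H"
  by (auto simp: perp_def bichar_eq_1 Z_closed subsetD intro!: Z_commute)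

text \<open>Any nontrivial commutator generates Z, which has order p, and \<chi> is injective on Z.
  So exponents below p serve as coordinates with respect to a noncommuting pair.\<close>

lemma bichar_powers:
  assumes "x \<in> carrier G" "y \<in> carrier G" "\<beta> x y \<noteq> 1"
  shows "inj_on (\<lambda>i. \<beta> x y ^ i) {..<p}"
    and "\<lbrakk>u \<in> carrier G; v \<in> carrier G\<rbrakk> \<Longrightarrow> \<exists>i<p. \<beta> u v = \<beta> x y ^ i"
proof -
  define c where "c = comm x y"
  have c: "c \<in> Z" "c \<noteq> \<one>" using assms by (auto simp: c_def comm_in_Z chi_one)
  have cZ: "c [^] (i::nat) \<in> Z" for i
    by (induction i) (use c subgroup_Z in \<open>auto simp: subgroup.m_closed subgroup.one_closed\<close>)
  have chi_pow: "\<chi> (c [^] (i::nat)) = \<chi> c ^ i" for i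
    by (induction i) (use c cZ in \<open>auto simp: chi_one chi_mult\<close>)
  have chi_inj: "a = b" if ab: "a \<in> Z" "b \<in> Z" "\<chi> a = \<chi> b" for a b
  proof -
    have ib: "inv b \<in> Z" using ab subgroup_Z by (simp add: subgroup.m_inv_closed)
    have "\<chi> (a \<otimes> inv b) = \<chi> (b \<otimes> inv b)" using ab ib by (simp only: chi_mult)
    then have "a \<otimes> inv b = \<one>"
      using ab ib subgroup_Z by (intro chi_faithful) (auto simp: subgroup.m_closed chi_one Z_closed)
    then show ?thesis using ab by (metis Z_closed inv_equality inv_inv inv_closed)
  qed
  note bij = Z_powers[OF c]
  show "inj_on (\<lambda>i. \<beta> x y ^ i) {..<p}"
    using bij_betw_imp_inj_on[OF bij] chi_inj cZ chi_pow unfolding c_def inj_on_def by metis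
  show "\<exists>i<p. \<beta> u v = \<beta> x y ^ i" if "u \<in> carrier G" "v \<in> carrier G"
    using bij_betw_imp_surj_on[OF bij] comm_in_Z[OF that] chi_pow unfolding c_def
    by (metis imageE lessThan_iff)
qed

text \<open>Peel off a hyperbolic pair \<open>x, y\<close> of \<open>K\<close>: every element of \<open>K\<close> is uniquely
  \<open>k \<otimes> (y\<^sup>a \<otimes> x\<^sup>b)\<close> with \<open>k\<close> orthogonal to \<open>x\<close> and \<open>y\<close>.\<close>

lemma hyperbolic_complement:
  assumes K: "subgroup K G" "Z \<subseteq> K" "K \<inter> perp K = Z" "card K > p"
    and gen: "\<And>g. g \<in> carrier G \<Longrightarrow> \<exists>h\<in>perp K. \<exists>k\<in>K. g = h \<otimes> k"
  shows "\<exists>L. subgroup L G \<and> Z \<subseteq> L \<and> L \<inter> perp L = Z \<and> card K = card L * p ^ 2 \<and>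
    (\<forall>g\<in>carrier G. \<exists>h\<in>perp L. \<exists>k\<in>L. g = h \<otimes> k)"
proof -
  have Kc: "K \<subseteq> carrier G" using K(1) by (rule subgroup.subset)
  have finK: "finite K" using Kc finite_G finite_subset by blast
  have "\<not> K \<subseteq> Z" using card_mono[of Z K] K(4) card_Z finK finite_subset[OF K(2)] by auto
  then obtain x where x: "x \<in> K" "x \<notin> Z" by blast
  then obtain y where y: "y \<in> K" "\<beta> x y \<noteq> 1" using K(3) Kc by (auto simp: perp_def)
  have xy: "x \<in> carrier G" "y \<in> carrier G" using x y Kc by auto
  have yx: "\<beta> y x \<noteq> 1" using y eq_1_commute xy by blast
  define L where "L = K \<inter> perp {x, y}"
  define e where "e a b = y [^] a \<otimes> x [^] b" for a b :: nat
  have pow_K: "u [^] (i::nat) \<in> K" if "u \<in> K" for u i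
    by (induction i) (use that K(1) in \<open>auto simp: subgroup.m_closed subgroup.one_closed\<close>)
  have eK: "e a b \<in> K" for a b
    using x y pow_K by (simp add: e_def subgroup.m_closed[OF K(1)])
  have eG: "e a b \<in> carrier G" for a b using eK Kc by blast
  \<comment> \<open>Pairing with x sees only the exponent of y, and pairing with y only that of
    x.\<close>
  have ex: "\<beta> (e a b) x = \<beta> y x ^ a" and ey: "\<beta> (e a b) y = \<beta> x y ^ b" for a b
    using xy alternating by (auto simp: e_def mult_left pow_left)
  have L: "subgroup L G"
    unfolding L_def using subgroups_Inter_pair K(1) subgroup_perp[of "{x, y}"] xy by auto
  have LK: "L \<subseteq> K" by (simp add: L_def)
  have ZL: "Z \<subseteq> L" using K(2) Z_perp[of "{x, y}"] xy by (auto simp: L_def)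
  \<comment> \<open>Choose the exponents to match the pairings of g with x and y; the quotient is
    then orthogonal to both.\<close>
  have decomp: "\<exists>k\<in>L. \<exists>a<p. \<exists>b<p. g = k \<otimes> e a b" if g: "g \<in> K" for g
  proof -
    have gG: "g \<in> carrier G" using g Kc by blast
    obtain a where a: "a < p" "\<beta> g x = \<beta> y x ^ a" using bichar_powers(2)[OF xy(2,1) yx gG xy(1)] by blast
    obtain b where b: "b < p" "\<beta> g y = \<beta> x y ^ b" using bichar_powers(2)[OF xy y(2) gG xy(2)] by blast
    have "g \<otimes> inv (e a b) \<in> L"
      using g eK gG eG K(1) xy a b nonzero[OF xy] nonzero[OF xy(2,1)]
      by (auto simp: L_def perp_def subgroup.m_closed subgroup.m_inv_closed mult_left inv_left ex ey)
    moreover have "g = g \<otimes> inv (e a b) \<otimes> e a b" using gG eG by (simp add: m_assoc)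
    ultimately show ?thesis using a b by blast
  qed
  have bij: "bij_betw (\<lambda>(k, a, b). k \<otimes> e a b) (L \<times> {..<p} \<times> {..<p}) K"
    unfolding bij_betw_def
  proof
    show "(\<lambda>(k, a, b). k \<otimes> e a b) ` (L \<times> {..<p} \<times> {..<p}) = K"
    proof
      show "(\<lambda>(k, a, b). k \<otimes> e a b) ` (L \<times> {..<p} \<times> {..<p}) \<subseteq> K"
        using LK eK K(1) by (auto simp: subgroup.m_closed)
      show "K \<subseteq> (\<lambda>(k, a, b). k \<otimes> e a b) ` (L \<times> {..<p} \<times> {..<p})"
      proof
        fix g assume "g \<in> K"
        then obtain k a b where "k \<in> L" "a < p" "b < p" "g = k \<otimes> e a b" using decomp by blast
        then show "g \<in> (\<lambda>(k, a, b). k \<otimes> e a b) ` (L \<times> {..<p} \<times> {..<p})"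
          by (intro image_eqI[of _ _ "(k, a, b)"]) auto
      qed
    qed
    have kx: "\<beta> (k \<otimes> e a b) x = \<beta> y x ^ a" "\<beta> (k \<otimes> e a b) y = \<beta> x y ^ b" if "k \<in> L" for k a b
      using that eG xy by (auto simp: L_def perp_def mult_left ex ey)
    show "inj_on (\<lambda>(k, a, b). k \<otimes> e a b) (L \<times> {..<p} \<times> {..<p})"
    proof (rule inj_onI)
      fix u v
      assume uv: "u \<in> L \<times> {..<p} \<times> {..<p}" "v \<in> L \<times> {..<p} \<times> {..<p}"
        "(\<lambda>(k, a, b). k \<otimes> e a b) u = (\<lambda>(k, a, b). k \<otimes> e a b) v"
      obtain k a b k' a' b' where u: "u = (k, a, b)" "v = (k', a', b')" by (metis prod_cases3)
      with uv have *: "k \<in> L" "k' \<in> L" "a < p" "b < p" "a' < p" "b' < p" "k \<otimes> e a b = k' \<otimes> e a' b'"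
        by auto
      then have "\<beta> y x ^ a = \<beta> y x ^ a'" "\<beta> x y ^ b = \<beta> x y ^ b'" using kx by metis+
      then have "a = a'" "b = b'"
        using * bichar_powers(1)[OF xy y(2)] bichar_powers(1)[OF xy(2,1) yx] by (auto simp: inj_on_def)
      moreover have "k \<in> carrier G" "k' \<in> carrier G" using * LK Kc by auto
      ultimately show "u = v" using * eG u by simp
    qed
  qed
  have card: "card K = card L * p ^ 2"
    using bij_betw_same_card[OF bij] by (simp add: card_cartesian_product power2_eq_square)
  have e_perp: "e a b \<in> perp L" for a b
  proof -
    have "\<beta> (e a b) k = 1" if "k \<in> L" for k
    proof -
      have k: "k \<in> carrier G" "\<beta> x k = 1" "\<beta> y k = 1" using that xy by (auto simp: L_def perp_def eq_1_commute)
      then show ?thesis using xy by (simp add: e_def mult_left pow_left)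
    qed
    then show ?thesis using eG by (simp add: perp_def)
  qed
  have "L \<inter> perp L = Z"
  proof
    show "L \<inter> perp L \<subseteq> Z"
    proof
      fix u assume u: "u \<in> L \<inter> perp L"
      then have uG: "u \<in> carrier G" and uK: "u \<in> K" using LK by (auto simp: perp_def)
      have "\<beta> u g = 1" if g: "g \<in> K" for g
      proof -
        obtain k a b where k: "k \<in> L" "g = k \<otimes> e a b" using decomp[OF g] by blast
        have "k \<in> carrier G" using k LK Kc by blast
        moreover have "\<beta> u (e a b) = 1" using perp_symmetric[OF e_perp] u L subgroup.subset by blast
        moreover have "\<beta> u k = 1" using u k by (auto simp: perp_def)
        ultimately show ?thesis using k uG eG by (simp add: mult_right)
      qed
      then show "u \<in> Z" using K(3) uG uK by (auto simp: perp_def)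
    qed
    show "Z \<subseteq> L \<inter> perp L" using ZL Z_perp subgroup.subset[OF L] by blast
  qed
  \<comment> \<open>\<open>e a b\<close> is orthogonal to L, so it commutes with k and can be moved
    over to the factor in \<open>perp L\<close>.\<close>
  moreover have "\<exists>h\<in>perp L. \<exists>k\<in>L. g = h \<otimes> k" if "g \<in> carrier G" for g
  proof -
    obtain h k0 where h: "h \<in> perp K" "k0 \<in> K" "g = h \<otimes> k0" using gen \<open>g \<in> carrier G\<close> by blast
    obtain k a b where k: "k \<in> L" "k0 = k \<otimes> e a b" using decomp h by blast
    have cl: "k \<in> carrier G" "h \<in> carrier G" using k h LK Kc by (auto simp: perp_def)
    have "\<beta> (e a b) k = 1" using e_perp k by (auto simp: perp_def)
    then have "e a b \<otimes> k = k \<otimes> e a b" using bichar_eq_1 cl eG by blast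
    then have "g = h \<otimes> e a b \<otimes> k" using h k cl eG by (simp add: m_assoc)
    moreover have "h \<otimes> e a b \<in> perp L"
    proof -
      have "h \<in> perp L" using h LK by (auto simp: perp_def)
      then show ?thesis
        using e_perp subgroup.m_closed[OF subgroup_perp[OF subgroup.subset[OF L]]] by blast
    qed
    ultimately show ?thesis using k by blast
  qed
  ultimately show ?thesis using L ZL card by blast
qed

text \<open>Downward induction from K = G, removing one hyperbolic pair and thereby a factor p^2 of
  the order in each step. The last clause makes G a central product of \<open>perp K\<close> and K,
  as orthogonal elements commute.\<close>

lemma nondegenerate_splitting:
  assumes card: "card (carrier G) = p ^ (2 * n + 1)" and "s \<le> n"
  shows "\<exists>K. subgroup K G \<and> Z \<subseteq> K \<and> K \<inter> perp K = Z \<and> card K = p ^ (2 * s + 1) \<and>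
    (\<forall>g\<in>carrier G. \<exists>h\<in>perp K. \<exists>k\<in>K. g = h \<otimes> k)"
proof -
  let ?P = "\<lambda>s K. subgroup K G \<and> Z \<subseteq> K \<and> K \<inter> perp K = Z \<and> card K = p ^ (2 * s + 1) \<and>
    (\<forall>g\<in>carrier G. \<exists>h\<in>perp K. \<exists>k\<in>K. g = h \<otimes> k)"
  from \<open>s \<le> n\<close> show "\<exists>K. ?P s K"
  proof (induction rule: inc_induct)
    case base
    have "\<exists>h\<in>perp (carrier G). \<exists>k\<in>carrier G. g = h \<otimes> k" if "g \<in> carrier G" for g
      using that by (rule_tac bexI[of _ \<one>], rule_tac bexI[of _ g]) (auto simp: perp_def)
    then have "?P n (carrier G)"
      using card perp_carrier Z_closed by (auto intro: subgroup_self)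
    then show ?case by blast
  next
    case (step s)
    then obtain K where K: "?P (Suc s) K" by blast
    have "p ^ 1 < p ^ (2 * Suc s + 1)"
      using prime_gt_1_nat[OF prime_p] by (intro power_strict_increasing) auto
    then have "card K > p" using K by simp
    with K obtain L where "subgroup L G" "Z \<subseteq> L" "L \<inter> perp L = Z" "card K = card L * p ^ 2"
      and "\<forall>g\<in>carrier G. \<exists>h\<in>perp L. \<exists>k\<in>L. g = h \<otimes> k"
      using hyperbolic_complement[of K] by blast
    moreover have "card L = p ^ (2 * s + 1)"
    proof -
      have "card L * p ^ 2 = p ^ (2 * s + 1) * p ^ 2"
        using \<open>card K = card L * p ^ 2\<close> K by (auto simp: power_add power2_eq_square)
      then show ?thesis using prime_gt_0_nat[OF prime_p] by simp
    qed
    ultimately have "?P s L" by blast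
    then show ?case by blast
  qed
qed

text \<open>Here \<open>n > 1\<close> enters: the centraliser of \<open>g\<close> has index at most \<open>p\<close>, hence is too
  large to be isotropic.\<close>

lemma centraliser_nonabelian:
  assumes card: "card (carrier G) = p ^ (2 * n + 1)" and "n > 1" and g: "g \<in> carrier G"
  obtains x y where "x \<in> carrier G" "y \<in> carrier G" "g \<otimes> x = x \<otimes> g" "g \<otimes> y = y \<otimes> g" "comm x y \<noteq> \<one>"
proof -
  define C where "C = perp {g}"
  have C: "subgroup C G" unfolding C_def using g by (intro subgroup_perp) auto
  have CG: "C \<subseteq> carrier G" using C by (rule subgroup.subset)
  have finC: "finite C" using CG finite_G finite_subset by blast
  \<comment> \<open>Elements with the same commutator with g differ by an element of C. There are at
    most p fibres, so C has index at most p.\<close>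
  have fibre: "card {h \<in> carrier G. comm h g = z} \<le> card C" for z
  proof (cases "{h \<in> carrier G. comm h g = z} = {}")
    case False
    then obtain h0 where h0: "h0 \<in> carrier G" "comm h0 g = z" by blast
    show ?thesis
    proof (rule card_inj_on_le[of "\<lambda>h. h \<otimes> inv h0" _ C])
      show "inj_on (\<lambda>h. h \<otimes> inv h0) {h \<in> carrier G. comm h g = z}"
        using h0 by (auto simp: inj_on_def)
      show "(\<lambda>h. h \<otimes> inv h0) ` {h \<in> carrier G. comm h g = z} \<subseteq> C"
        using h0 g nonzero[of h0 g] by (auto simp: C_def perp_def mult_left inv_left)
    qed (rule finC)
  qed (metis card.empty le0)
  have "carrier G = (\<Union>z\<in>Z. {h \<in> carrier G. comm h g = z})" using comm_in_Z g by auto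
  then have "card (carrier G) \<le> (\<Sum>z\<in>Z. card {h \<in> carrier G. comm h g = z})"
    using card_UN_le[of Z "\<lambda>z. {h \<in> carrier G. comm h g = z}"] card_Z prime_gt_0_nat[OF prime_p]
    by (metis card_ge_0_finite)
  also have "\<dots> \<le> p * card C" using sum_bounded_above[of Z _ "card C"] fibre card_Z by simp
  finally have "p ^ (2 * n) \<le> card C" using card prime_gt_0_nat[OF prime_p] by simp
  \<comment> \<open>Otherwise \<open>p^(4n) \<le> |C|^2 \<le> |G| |Z| = p^(2n+2)\<close>, which
    fails for n > 1.\<close>
  have "\<not> isotropic C"
  proof
    assume "isotropic C"
    then have "card C ^ 2 \<le> p ^ (2 * n + 1) * p"
      using isotropic_card_le[OF C] perp_carrier card card_Z by simp
    moreover have "(p ^ (2 * n)) ^ 2 \<le> card C ^ 2" using \<open>p ^ (2 * n) \<le> card C\<close> by (rule power_mono) simp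
    moreover have "p ^ (2 * n + 1) * p = p ^ (2 * n + 2)" "(p ^ (2 * n)) ^ 2 = p ^ (4 * n)"
      by (simp_all flip: power_mult)
    ultimately have "p ^ (4 * n) \<le> p ^ (2 * n + 2)" by linarith
    then have "4 * n \<le> 2 * n + 2" using prime_gt_1_nat[OF prime_p] by (simp only: power_increasing_iff)
    with \<open>n > 1\<close> show False by simp
  qed
  then obtain x y where xy: "x \<in> C" "y \<in> C" "\<beta> x y \<noteq> 1" by (auto simp: isotropic_def)
  then have cl: "x \<in> carrier G" "y \<in> carrier G" using CG by auto
  show thesis
  proof (rule that[OF cl])
    show "g \<otimes> x = x \<otimes> g" "g \<otimes> y = y \<otimes> g" using xy cl g bichar_eq_1 by (auto simp: C_def perp_def)
    show "comm x y \<noteq> \<one>" using xy(3) chi_one by auto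
  qed
qed

end

lemma (in extra_special_group) faithful_center_character:
  obtains \<chi> where "extra_special_character G p \<chi>"
proof -
  obtain \<chi> :: "'a \<Rightarrow> complex"
    where "\<And>a b. a \<in> Z \<Longrightarrow> b \<in> Z \<Longrightarrow> \<chi> (a \<otimes> b) = \<chi> a * \<chi> b"
    and "\<And>a. a \<in> Z \<Longrightarrow> \<chi> a \<noteq> 0" and "\<And>z. z \<in> Z \<Longrightarrow> \<chi> z = 1 \<Longrightarrow> z = \<one>"
    using prime_order_character[OF finite_G subgroup_Z] card_Z prime_p Z_commute Z_closed by metis
  then have "extra_special_character G p \<chi>" by unfold_locales
  then show thesis by (rule that)
qed

section \<open>Induced representations and the construction of a faithful one\<close>

lemma smult_smult_mat: "a \<cdot>\<^sub>m (b \<cdot>\<^sub>m A) = (a * b :: complex) \<cdot>\<^sub>m A"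
  by (rule eq_matI) auto

lemma one_smult_mat: "(1::complex) \<cdot>\<^sub>m A = A"
  by (rule eq_matI) auto

lemma smult_mat_cancel:
  fixes M :: "complex mat"
  assumes "M \<in> carrier_mat m m" "N \<in> carrier_mat m m" "M * N = d \<cdot>\<^sub>m 1\<^sub>m m" "d \<noteq> 0" "m > 0"
    and "c \<cdot>\<^sub>m M = c' \<cdot>\<^sub>m M"
  shows "c = c'"
proof -
  have "c \<cdot>\<^sub>m (M * N) = c' \<cdot>\<^sub>m (M * N)"
    using assms by (metis mult_smult_assoc_mat)
  then have "(c \<cdot>\<^sub>m (d \<cdot>\<^sub>m 1\<^sub>m m)) $$ (0, 0) = (c' \<cdot>\<^sub>m (d \<cdot>\<^sub>m (1\<^sub>m m :: complex mat))) $$ (0, 0)"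
    using assms(3) by simp
  then show ?thesis using assms(4,5) by simp
qed

lemma smult_one_mat_inject:
  "m > 0 \<Longrightarrow> c \<cdot>\<^sub>m 1\<^sub>m m = c' \<cdot>\<^sub>m (1\<^sub>m m :: complex mat) \<longleftrightarrow> c = c'"
  by (auto dest: arg_cong[of _ _ "\<lambda>M. M $$ (0, 0)"])

context group
begin

text \<open>The scalars are determined by the matrices, and associativity of the matrix product
  becomes the cocycle identity. Cancelling the matrix of x y z requires m > 0: matrices of size 0 do
  not determine a scalar factor.\<close>

lemma proj_repI:
  assumes m: "m > 0" and carr: "\<And>g. g \<in> carrier G \<Longrightarrow> \<rho> g \<in> carrier_mat m m"
    and one: "\<rho> \<one> = 1\<^sub>m m"
    and mult: "\<And>g h. g \<in> carrier G \<Longrightarrow> h \<in> carrier G \<Longrightarrow> \<exists>c\<noteq>0. \<rho> g * \<rho> h = c \<cdot>\<^sub>m \<rho> (g \<otimes> h)"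
  shows "proj_rep G m \<rho>"
proof -
  define \<alpha> where "\<alpha> g h = (SOME c. c \<noteq> 0 \<and> \<rho> g * \<rho> h = c \<cdot>\<^sub>m \<rho> (g \<otimes> h))" for g h
  have \<alpha>: "\<alpha> g h \<noteq> 0" "\<rho> g * \<rho> h = \<alpha> g h \<cdot>\<^sub>m \<rho> (g \<otimes> h)" if "g \<in> carrier G" "h \<in> carrier G" for g h
    using someI_ex[of "\<lambda>c. c \<noteq> 0 \<and> \<rho> g * \<rho> h = c \<cdot>\<^sub>m \<rho> (g \<otimes> h)"] mult[OF that]
    by (auto simp: \<alpha>_def)
  have inverse: "\<rho> g * \<rho> (inv g) = \<alpha> g (inv g) \<cdot>\<^sub>m 1\<^sub>m m" "\<alpha> g (inv g) \<noteq> 0" if "g \<in> carrier G" for g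
    using \<alpha>[OF that inv_closed[OF that]] that one by auto
  have "det (\<rho> g) \<noteq> 0" if "g \<in> carrier G" for g
  proof -
    have "det (\<rho> g) * det (\<rho> (inv g)) = \<alpha> g (inv g) ^ m"
      using det_mult[OF carr carr, of g "inv g"] inverse(1)[OF that] that by simp
    then show ?thesis using inverse(2)[OF that] by auto
  qed
  moreover have "\<alpha> x y * \<alpha> (x \<otimes> y) z = \<alpha> y z * \<alpha> x (y \<otimes> z)"
    if cl: "x \<in> carrier G" "y \<in> carrier G" "z \<in> carrier G" for x y z
  proof -
    have "(\<alpha> x y * \<alpha> (x \<otimes> y) z) \<cdot>\<^sub>m \<rho> (x \<otimes> y \<otimes> z) = \<alpha> x y \<cdot>\<^sub>m (\<rho> (x \<otimes> y) * \<rho> z)"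
      using cl \<alpha>(2) by (simp add: smult_smult_mat)
    also have "\<dots> = (\<rho> x * \<rho> y) * \<rho> z"
      using cl by (simp add: \<alpha>(2) mult_smult_assoc_mat[OF carr carr])
    also have "\<dots> = \<rho> x * (\<rho> y * \<rho> z)"
      using cl carr by (intro assoc_mult_mat) auto
    also have "\<dots> = \<alpha> y z \<cdot>\<^sub>m (\<rho> x * \<rho> (y \<otimes> z))"
      using cl by (simp add: \<alpha>(2)[OF cl(2,3)] mult_smult_distrib[OF carr carr])
    also have "\<dots> = (\<alpha> y z * \<alpha> x (y \<otimes> z)) \<cdot>\<^sub>m \<rho> (x \<otimes> y \<otimes> z)"
      using cl \<alpha>(2) by (simp add: smult_smult_mat m_assoc)
    finally have eq: "(\<alpha> x y * \<alpha> (x \<otimes> y) z) \<cdot>\<^sub>m \<rho> (x \<otimes> y \<otimes> z) = (\<alpha> y z * \<alpha> x (y \<otimes> z)) \<cdot>\<^sub>m \<rho> (x \<otimes> y \<otimes> z)" .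
    have xyz: "x \<otimes> y \<otimes> z \<in> carrier G" using cl by simp
    show ?thesis
      by (rule smult_mat_cancel[OF carr[OF xyz] carr[OF inv_closed[OF xyz]] inverse[OF xyz] m eq])
  qed
  ultimately show ?thesis
    unfolding proj_rep_def cocycle2_def alpha_rep_def using \<alpha> carr one by (intro exI[of _ \<alpha>]) auto
qed

text \<open>For a transversal \<open>t\<close> and a character \<psi> of A, this is the matrix of
  the induced representation; it is monomial, the entry in row i being placed by the coset of
  \<open>t i \<otimes> h\<close>.\<close>

definition induced :: "'a set \<Rightarrow> ('a \<Rightarrow> complex) \<Rightarrow> nat \<Rightarrow> (nat \<Rightarrow> 'a) \<Rightarrow> 'a \<Rightarrow> complex mat" where
  "induced A \<psi> N t h = mat N N (\<lambda>(i, j).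
     if t i \<otimes> h \<otimes> inv (t j) \<in> A then \<psi> (t i \<otimes> h \<otimes> inv (t j)) else 0)"

lemma induced_carrier [simp]: "induced A \<psi> N t h \<in> carrier_mat N N"
  by (simp add: induced_def)

lemma induced_mult:
  assumes A: "subgroup A G" and H: "subgroup H G"
    and psi: "\<And>a b. a \<in> A \<Longrightarrow> b \<in> A \<Longrightarrow> \<psi> (a \<otimes> b) = \<psi> a * \<psi> b"
    and t: "\<And>i. i < N \<Longrightarrow> t i \<in> H"
    and trans: "\<And>h. h \<in> H \<Longrightarrow> \<exists>!i. i < N \<and> h \<otimes> inv (t i) \<in> A"
    and h: "h \<in> H" "k \<in> H"
  shows "induced A \<psi> N t (h \<otimes> k) = induced A \<psi> N t h * induced A \<psi> N t k"
proof (rule eq_matI)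
  have HG: "H \<subseteq> carrier G" and AG: "A \<subseteq> carrier G" using A H by (auto dest: subgroup.subset)
  fix i l assume "i < dim_row (induced A \<psi> N t h * induced A \<psi> N t k)"
    "l < dim_col (induced A \<psi> N t h * induced A \<psi> N t k)"
  then have il: "i < N" "l < N" by (auto simp: induced_def)
  let ?e = "\<lambda>x. if x \<in> A then \<psi> x else 0"
  have cl: "h \<in> carrier G" "k \<in> carrier G" "t i \<in> carrier G" "t l \<in> carrier G"
    using HG h t il by auto
  have "t i \<otimes> h \<in> H" using t il h H by (simp add: subgroup.m_closed)
  \<comment> \<open>Row i of the left factor vanishes away from this j, so the matrix product
    reduces to a single summand.\<close>
  then obtain j where j: "j < N" "t i \<otimes> h \<otimes> inv (t j) \<in> A"
    and uniq: "\<And>j'. j' < N \<Longrightarrow> t i \<otimes> h \<otimes> inv (t j') \<in> A \<Longrightarrow> j' = j"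
    using trans by metis
  have tj: "t j \<in> carrier G" using t j HG by auto
  let ?a = "t i \<otimes> h \<otimes> inv (t j)" and ?b = "t j \<otimes> k \<otimes> inv (t l)"
  have ab: "t i \<otimes> (h \<otimes> k) \<otimes> inv (t l) = ?a \<otimes> ?b"
  proof -
    have "inv (t j) \<otimes> (t j \<otimes> u) = u" if "u \<in> carrier G" for u
      using tj that by (simp flip: m_assoc)
    then show ?thesis using cl tj by (simp add: m_assoc)
  qed
  have b_iff: "?a \<otimes> ?b \<in> A \<longleftrightarrow> ?b \<in> A"
  proof
    assume "?a \<otimes> ?b \<in> A"
    then have "inv ?a \<otimes> (?a \<otimes> ?b) \<in> A"
      by (intro subgroup.m_closed[OF A subgroup.m_inv_closed[OF A j(2)]])
    moreover have "inv ?a \<otimes> (?a \<otimes> ?b) = ?b"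
      using cl tj by (subst m_assoc [symmetric]) auto
    ultimately show "?b \<in> A" by simp
  qed (rule subgroup.m_closed[OF A j(2)])
  have "(induced A \<psi> N t h * induced A \<psi> N t k) $$ (i, l)
      = (\<Sum>j'<N. ?e (t i \<otimes> h \<otimes> inv (t j')) * ?e (t j' \<otimes> k \<otimes> inv (t l)))"
    using il by (simp add: induced_def scalar_prod_def atLeast0LessThan)
  also have "\<dots> = (\<Sum>j'\<in>{j}. ?e (t i \<otimes> h \<otimes> inv (t j')) * ?e (t j' \<otimes> k \<otimes> inv (t l)))"
  proof (rule sum.mono_neutral_right)
    show "\<forall>j'\<in>{..<N} - {j}. ?e (t i \<otimes> h \<otimes> inv (t j')) * ?e (t j' \<otimes> k \<otimes> inv (t l)) = 0"
    proof
      fix j' assume "j' \<in> {..<N} - {j}"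
      then have "t i \<otimes> h \<otimes> inv (t j') \<notin> A" using uniq by blast
      then show "?e (t i \<otimes> h \<otimes> inv (t j')) * ?e (t j' \<otimes> k \<otimes> inv (t l)) = 0" by simp
    qed
  qed (use j in auto)
  also have "\<dots> = ?e (?a \<otimes> ?b)"
  proof (cases "?b \<in> A")
    case True
    then show ?thesis using j(2) psi[OF j(2) True] subgroup.m_closed[OF A j(2) True] by simp
  next
    case False
    then have "?a \<otimes> ?b \<notin> A" using b_iff by blast
    with False show ?thesis by simp
  qed
  also have "\<dots> = induced A \<psi> N t (h \<otimes> k) $$ (i, l)"
    using il by (simp add: induced_def ab)
  finally show "induced A \<psi> N t (h \<otimes> k) $$ (i, l) = (induced A \<psi> N t h * induced A \<psi> N t k) $$ (i, l)"
    by simp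
qed (auto simp: induced_def)

lemma induced_central:
  assumes A: "subgroup A G" and H: "subgroup H G"
    and t: "\<And>i. i < N \<Longrightarrow> t i \<in> H"
    and trans: "\<And>h. h \<in> H \<Longrightarrow> \<exists>!i. i < N \<and> h \<otimes> inv (t i) \<in> A"
    and z: "z \<in> A" "\<And>h. h \<in> H \<Longrightarrow> z \<otimes> h = h \<otimes> z"
  shows "induced A \<psi> N t z = \<psi> z \<cdot>\<^sub>m 1\<^sub>m N"
proof (rule eq_matI)
  have HG: "H \<subseteq> carrier G" and AG: "A \<subseteq> carrier G" using A H by (auto dest: subgroup.subset)
  fix i j assume "i < dim_row (\<psi> z \<cdot>\<^sub>m 1\<^sub>m N)" "j < dim_col (\<psi> z \<cdot>\<^sub>m 1\<^sub>m N)"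
  then have ij: "i < N" "j < N" by auto
  have cl: "t i \<in> carrier G" "t j \<in> carrier G" "z \<in> carrier G" using ij t HG AG z by auto
  have comm: "t i \<otimes> z \<otimes> inv (t j) = z \<otimes> (t i \<otimes> inv (t j))"
    using cl z(2)[OF t[OF ij(1)]] by (simp add: m_assoc flip: z(2)) (simp add: m_assoc [symmetric])
  show "induced A \<psi> N t z $$ (i, j) = (\<psi> z \<cdot>\<^sub>m 1\<^sub>m N) $$ (i, j)"
  proof (cases "i = j")
    case True
    then show ?thesis using ij comm cl z(1) by (simp add: induced_def)
  next
    case False
    have "t i \<otimes> z \<otimes> inv (t j) \<notin> A"
    proof
      assume "t i \<otimes> z \<otimes> inv (t j) \<in> A"
      then have "inv z \<otimes> (z \<otimes> (t i \<otimes> inv (t j))) \<in> A"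
        unfolding comm by (rule subgroup.m_closed[OF A subgroup.m_inv_closed[OF A z(1)]])
      then have "t i \<otimes> inv (t j) \<in> A" using cl by (simp flip: m_assoc)
      moreover have "t i \<otimes> inv (t i) \<in> A" using cl A by (simp add: subgroup.one_closed)
      ultimately show False using trans[OF t[OF ij(1)]] ij False by blast
    qed
    then show ?thesis using ij False by (simp add: induced_def)
  qed
qed (auto simp: induced_def)

end

section \<open>Representations with prescribed central character\<close>

context extra_special_character
begin

text \<open>The Heisenberg representation: extend \<eta> to a Lagrangian A of H and induce, which
  gives degree \<open>[H : A] = p^r\<close>. If h acts as a scalar, the diagonal entries force h
  into A and make every \<open>\<eta> (comm (t i) h)\<close> equal to 1, so h commutes with A and
  with all coset representatives. \<eta> is separate from \<chi> because the lemma is applied to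
  \<chi> and to its inverse.\<close>

lemma central_type_representation:
  assumes H: "subgroup H G" "Z \<subseteq> H" "H \<inter> perp H = Z" "card H = p ^ (2 * r + 1)"
    and eta: "\<And>a b. a \<in> Z \<Longrightarrow> b \<in> Z \<Longrightarrow> \<eta> (a \<otimes> b) = \<eta> a * \<eta> b" "\<And>a. a \<in> Z \<Longrightarrow> \<eta> a \<noteq> 0"
      "\<And>a. a \<in> Z \<Longrightarrow> \<eta> a = 1 \<Longrightarrow> a = \<one>"
  shows "\<exists>\<sigma>. (\<forall>h. \<sigma> h \<in> carrier_mat (p ^ r) (p ^ r)) \<and>
    (\<forall>h\<in>H. \<forall>k\<in>H. \<sigma> (h \<otimes> k) = \<sigma> h * \<sigma> k) \<and> (\<forall>z\<in>Z. \<sigma> z = \<eta> z \<cdot>\<^sub>m 1\<^sub>m (p ^ r)) \<and>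
    (\<forall>h\<in>H. is_scalar_mat (p ^ r) (\<sigma> h) \<longrightarrow> h \<in> Z)"
proof -
  have HG: "H \<subseteq> carrier G" using H(1) by (rule subgroup.subset)
  obtain A where A: "subgroup A G" "A \<subseteq> H" "isotropic A" "H \<inter> perp A = A"
    "card A ^ 2 = card H * card (H \<inter> perp H)"
    using lagrangian_exists[OF H(1)] by blast
  have AG: "A \<subseteq> carrier G" using A HG by blast
  have p0: "p > 0" using prime_gt_0_nat[OF prime_p] .
  \<comment> \<open>The radical of H is Z, of order p, so |A|^2 is
    \<open>p^(2r+1) * p\<close>.\<close>
  have "card A ^ 2 = (p ^ (r + 1)) ^ 2"
    using A(5) H(3,4) card_Z by (simp add: power2_eq_square power_add mult_2 mult_2_right algebra_simps)
  then have cardA: "card A = p ^ (r + 1)" by (simp add: power2_eq_iff_nonneg)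
  have ZA: "Z \<subseteq> A" using A(4) H(2) Z_perp[OF AG] by blast
  have commA: "a \<otimes> b = b \<otimes> a" if "a \<in> A" "b \<in> A" for a b
    using A(3) AG that bichar_eq_1[of a b] by (auto simp: isotropic_def)
  obtain \<psi> :: "'a \<Rightarrow> complex" where psi: "\<And>a b. a \<in> A \<Longrightarrow> b \<in> A \<Longrightarrow> \<psi> (a \<otimes> b) = \<psi> a * \<psi> b"
    "\<And>a. a \<in> A \<Longrightarrow> \<psi> a \<noteq> 0" "\<And>z. z \<in> Z \<Longrightarrow> \<psi> z = \<eta> z"
    using character_extension[OF finite_G A(1) commA subgroup_Z ZA eta(1,2)] by blast
  obtain N t where N: "card H = N * card A" and t': "\<forall>i<N. t i \<in> H"
    and trans': "\<forall>h\<in>H. \<exists>!i. i < N \<and> h \<otimes> inv (t i) \<in> A"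
    using subgroup_transversal[OF finite_G A(1) H(1) A(2)] by (elim exE conjE) (rule that)
  have t: "\<And>i. i < N \<Longrightarrow> t i \<in> H"
    and trans: "\<And>h. h \<in> H \<Longrightarrow> \<exists>!i. i < N \<and> h \<otimes> inv (t i) \<in> A"
    using t' trans' by simp_all
  have "N * p ^ (r + 1) = p ^ (2 * r + 1)" by (metis N H(4) cardA)
  also have "\<dots> = p ^ r * p ^ (r + 1)" by (simp add: mult_2 power_add)
  finally have "N * p ^ (r + 1) = p ^ r * p ^ (r + 1)" .
  with p0 have Nr: "N = p ^ r" by simp
  have N0: "N > 0" using Nr p0 by simp
  define \<sigma> where "\<sigma> = induced A \<psi> N t"
  have mult: "\<sigma> (h \<otimes> k) = \<sigma> h * \<sigma> k" if "h \<in> H" "k \<in> H" for h k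
    unfolding \<sigma>_def using induced_mult[OF A(1) H(1) psi(1) t trans that] by blast
  have central: "\<sigma> z = \<eta> z \<cdot>\<^sub>m 1\<^sub>m N" if "z \<in> Z" for z
  proof -
    have "\<sigma> z = \<psi> z \<cdot>\<^sub>m 1\<^sub>m N" unfolding \<sigma>_def
      by (rule induced_central[OF A(1) H(1) t trans]) (use that ZA HG Z_commute in blast)+
    then show ?thesis using psi(3) that by simp
  qed
  have scalar: "h \<in> Z" if h: "h \<in> H" "is_scalar_mat N (\<sigma> h)" for h
  proof -
    have hG: "h \<in> carrier G" using h HG by blast
    obtain c where c: "\<sigma> h = c \<cdot>\<^sub>m 1\<^sub>m N" using h by (auto simp: is_scalar_mat_def)
    have one: "\<sigma> \<one> = 1 \<cdot>\<^sub>m 1\<^sub>m N"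
      using central[of \<one>] eta(1)[of \<one> \<one>] eta(2)[of \<one>] subgroup.one_closed[OF subgroup_Z] by simp
    have "c \<noteq> 0"
    proof
      assume "c = 0"
      have hi: "inv h \<in> H" using h H(1) by (simp add: subgroup.m_inv_closed)
      have "\<sigma> h * \<sigma> (inv h) = 1 \<cdot>\<^sub>m 1\<^sub>m N" using mult[OF h(1) hi] hG one by simp
      moreover have "\<sigma> h * \<sigma> (inv h) = 0 \<cdot>\<^sub>m \<sigma> (inv h)"
        using c \<open>c = 0\<close> mult_smult_assoc_mat[of "1\<^sub>m N" N N "\<sigma> (inv h)" N c]
          left_mult_one_mat[of "\<sigma> (inv h)" N N] by (simp add: \<sigma>_def)
      ultimately have "(1 \<cdot>\<^sub>m 1\<^sub>m N) $$ (0, 0) = (0 \<cdot>\<^sub>m \<sigma> (inv h)) $$ (0, 0)" by simp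
      then show False using N0 by (simp add: \<sigma>_def induced_def)
    qed
    \<comment> \<open>A nonzero diagonal entry means that the conjugate of h by \<open>t i\<close>
      lies in A; this conjugate differs from h only by a central commutator.\<close>
    have diag: "h \<in> A \<and> c = \<eta> (comm (t i) h) * \<psi> h" if i: "i < N" for i
    proof -
      have ti: "t i \<in> carrier G" using i t HG by blast
      let ?x = "t i \<otimes> h \<otimes> inv (t i)"
      have "(c \<cdot>\<^sub>m 1\<^sub>m N) $$ (i, i) = (if ?x \<in> A then \<psi> ?x else 0)"
        unfolding c [symmetric] using i by (simp add: \<sigma>_def induced_def)
      then have x: "?x \<in> A" "\<psi> ?x = c" using \<open>c \<noteq> 0\<close> i by (auto split: if_splits)
      have cZ: "comm (t i) h \<in> Z" using comm_in_Z ti hG .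
      have cA: "comm (t i) h \<in> A" using cZ ZA by blast
      have xe: "?x = comm (t i) h \<otimes> h" using ti hG by (simp add: comm_def m_assoc)
      have "inv (comm (t i) h) \<otimes> ?x \<in> A"
        by (rule subgroup.m_closed[OF A(1) subgroup.m_inv_closed[OF A(1) cA] x(1)])
      moreover have "inv (comm (t i) h) \<otimes> ?x = h"
        unfolding xe using comm_closed[OF ti hG] hG by (simp flip: m_assoc)
      ultimately have hA: "h \<in> A" by simp
      have "c = \<psi> (comm (t i) h \<otimes> h)" using x(2) unfolding xe by simp
      then show ?thesis using psi cA cZ hA by simp
    qed
    have hA: "h \<in> A" using diag N0 by blast
    \<comment> \<open>The representative of the coset A itself commutes with h, which identifies the
      scalar as \<psi> h.\<close>
    obtain i0 where i0: "i0 < N" "\<one> \<otimes> inv (t i0) \<in> A"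
      using trans[of \<one>] subgroup.one_closed[OF H(1)] by blast
    have ti0: "t i0 \<in> A"
      using subgroup.m_inv_closed[OF A(1) i0(2)] t[OF i0(1)] HG by auto
    have "comm (t i0) h = \<one>" using comm_eq_one[of "t i0" h] commA[OF ti0 hA] ti0 hA AG by auto
    then have ch: "c = \<psi> h" using diag[OF i0(1)] eta(1)[of \<one> \<one>] eta(2)[of \<one>]
        subgroup.one_closed[OF subgroup_Z] by simp
    have th: "\<beta> (t i) h = 1" if "i < N" for i
    proof -
      have "\<eta> (comm (t i) h) = 1" using diag[OF that] ch \<open>c \<noteq> 0\<close> by simp
      then have "comm (t i) h = \<one>" using eta(3) comm_in_Z t[OF that] HG hG by blast
      then show ?thesis by (simp add: chi_one)
    qed
    have "\<beta> h k = 1" if k: "k \<in> H" for k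
    proof -
      obtain i where i: "i < N" "k \<otimes> inv (t i) \<in> A" using trans[OF k] by blast
      have cl: "k \<in> carrier G" "t i \<in> carrier G" using k t[OF i(1)] HG by auto
      have "\<beta> (k \<otimes> inv (t i)) h = 1" using A(3) i hA by (auto simp: isotropic_def)
      then have "\<beta> k h = 1" using th[OF i(1)] cl hG by (simp add: mult_left inv_left)
      then show ?thesis using eq_1_commute cl hG by blast
    qed
    then show ?thesis using H(3) h(1) hG by (auto simp: perp_def)
  qed
  show ?thesis unfolding Nr [symmetric]
    using mult central scalar by (intro exI[of _ \<sigma>]) (auto simp: \<sigma>_def)
qed

text \<open>Write \<open>G = H K\<close> with \<open>H = perp K\<close>. The representations \<open>\<sigma>\<close> of \<open>H\<close> and \<open>\<tau>\<close> of \<open>K\<close> have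
  inverse central characters, so \<open>h k \<mapsto> \<sigma> h \<oplus> \<tau> k\<close> depends on the choice of
  \<open>(h, k)\<close> only up to a scalar.\<close>

lemma faithful_projective_exists:
  assumes card: "card (carrier G) = p ^ (2 * n + 1)" and "s \<le> n"
  shows "\<exists>\<rho>. proj_rep G (p ^ (n - s) + p ^ s) \<rho> \<and> faithful_proj G (p ^ (n - s) + p ^ s) \<rho>"
proof -
  have p0: "p > 0" using prime_gt_0_nat[OF prime_p] .
  obtain K where K: "subgroup K G" "Z \<subseteq> K" "K \<inter> perp K = Z" "card K = p ^ (2 * s + 1)"
    and gen: "\<And>g. g \<in> carrier G \<Longrightarrow> \<exists>h\<in>perp K. \<exists>k\<in>K. g = h \<otimes> k"
    using nondegenerate_splitting[OF card \<open>s \<le> n\<close>] by blast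
  have KG: "K \<subseteq> carrier G" using K(1) by (rule subgroup.subset)
  define H where "H = perp K"
  have HG: "H \<subseteq> carrier G" by (auto simp: H_def perp_def)
  have HK: "h \<otimes> k = k \<otimes> h" if "h \<in> H" "k \<in> K" for h k
    using that bichar_eq_1[of h k] HG KG by (auto simp: H_def perp_def)
  have H: "subgroup H G" "Z \<subseteq> H" using subgroup_perp Z_perp KG by (auto simp: H_def)
  have "H \<inter> perp H \<subseteq> Z"
  proof
    fix u assume u: "u \<in> H \<inter> perp H"
    then have uG: "u \<in> carrier G" using HG by blast
    have "\<beta> u g = 1" if g: "g \<in> carrier G" for g
    proof -
      obtain h k where hk: "h \<in> H" "k \<in> K" "g = h \<otimes> k" using gen[OF g] by (auto simp: H_def)
      have "\<beta> u h = 1" using u hk by (auto simp: perp_def)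
      moreover have "\<beta> u k = 1" using u hk by (auto simp: perp_def H_def)
      ultimately show ?thesis using hk uG HG KG by (auto simp: mult_right subset_iff)
    qed
    then show "u \<in> Z" using uG unfolding perp_carrier [symmetric] by (simp add: perp_def)
  qed
  then have H3: "H \<inter> perp H = Z" using H(2) Z_perp[OF HG] by blast
  \<comment> \<open>Counting K against G: |G| |Z| = |K| |H|.\<close>
  have "p ^ (2 * n + 1) * p = p ^ (2 * s + 1) * card H"
  proof -
    have "card (K \<inter> perp (carrier G)) = p" using K(2) perp_carrier card_Z by (metis Int_absorb1)
    moreover have "carrier G \<inter> perp K = H" using HG by (auto simp: H_def)
    ultimately show ?thesis using card_perp_symmetric[OF K(1) subgroup_self] card K(4) by simp
  qed
  moreover have "p ^ (2 * n + 1) * p = p ^ (2 * s + 1) * p ^ (2 * (n - s) + 1)"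
  proof -
    have "2 * n + 2 = (2 * s + 1) + (2 * (n - s) + 1)" using \<open>s \<le> n\<close> by simp
    then show ?thesis by (metis power_add power_Suc2 add_2_eq_Suc' Suc_eq_plus1)
  qed
  ultimately have H4: "card H = p ^ (2 * (n - s) + 1)" using p0 by simp
  let ?q = "p ^ (n - s)" and ?r = "p ^ s"
  obtain \<sigma> where \<sigma>: "\<And>h. \<sigma> h \<in> carrier_mat ?q ?q"
    "\<And>h k. h \<in> H \<Longrightarrow> k \<in> H \<Longrightarrow> \<sigma> (h \<otimes> k) = \<sigma> h * \<sigma> k"
    "\<And>z. z \<in> Z \<Longrightarrow> \<sigma> z = \<chi> z \<cdot>\<^sub>m 1\<^sub>m ?q"
    "\<And>h. h \<in> H \<Longrightarrow> is_scalar_mat ?q (\<sigma> h) \<Longrightarrow> h \<in> Z"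
    using central_type_representation[OF H H3 H4 chi_mult chi_nonzero chi_faithful] by blast
  have "\<exists>\<tau>. (\<forall>h. \<tau> h \<in> carrier_mat ?r ?r) \<and>
    (\<forall>h\<in>K. \<forall>k\<in>K. \<tau> (h \<otimes> k) = \<tau> h * \<tau> k) \<and> (\<forall>z\<in>Z. \<tau> z = inverse (\<chi> z) \<cdot>\<^sub>m 1\<^sub>m ?r) \<and>
    (\<forall>h\<in>K. is_scalar_mat ?r (\<tau> h) \<longrightarrow> h \<in> Z)"
    by (rule central_type_representation[OF K]) (auto simp: chi_mult chi_nonzero chi_faithful)
  then obtain \<tau> where \<tau>: "\<And>h. \<tau> h \<in> carrier_mat ?r ?r"
    "\<And>h k. h \<in> K \<Longrightarrow> k \<in> K \<Longrightarrow> \<tau> (h \<otimes> k) = \<tau> h * \<tau> k"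
    "\<And>z. z \<in> Z \<Longrightarrow> \<tau> z = inverse (\<chi> z) \<cdot>\<^sub>m 1\<^sub>m ?r"
    "\<And>h. h \<in> K \<Longrightarrow> is_scalar_mat ?r (\<tau> h) \<Longrightarrow> h \<in> Z"
    by blast
  have Z1: "\<one> \<in> Z" using subgroup.one_closed[OF subgroup_Z] .
  \<comment> \<open>The identity is split as (1, 1); another splitting would only make its image a
    scalar matrix.\<close>
  have "\<forall>g\<in>carrier G. \<exists>x. fst x \<in> H \<and> snd x \<in> K \<and> g = fst x \<otimes> snd x \<and> (g = \<one> \<longrightarrow> x = (\<one>, \<one>))"
  proof
    fix g assume g: "g \<in> carrier G"
    show "\<exists>x. fst x \<in> H \<and> snd x \<in> K \<and> g = fst x \<otimes> snd x \<and> (g = \<one> \<longrightarrow> x = (\<one>, \<one>))"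
    proof (cases "g = \<one>")
      case True
      then show ?thesis using Z1 H(2) K(2) by (intro exI[of _ "(\<one>, \<one>)"]) auto
    next
      case False
      then show ?thesis using gen[OF g] by (auto simp: H_def)
    qed
  qed
  then obtain x where x: "\<And>g. g \<in> carrier G \<Longrightarrow> fst (x g) \<in> H" "\<And>g. g \<in> carrier G \<Longrightarrow> snd (x g) \<in> K"
    "\<And>g. g \<in> carrier G \<Longrightarrow> g = fst (x g) \<otimes> snd (x g)" "x \<one> = (\<one>, \<one>)"
    using bchoice[of "carrier G" "\<lambda>g x. fst x \<in> H \<and> snd x \<in> K \<and> g = fst x \<otimes> snd x \<and> (g = \<one> \<longrightarrow> x = (\<one>, \<one>))"]
    by (metis one_closed)
  define \<rho> where "\<rho> g = four_block_mat (\<sigma> (fst (x g))) (0\<^sub>m ?q ?r) (0\<^sub>m ?r ?q) (\<tau> (snd (x g)))" for g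
  have carr: "\<rho> g \<in> carrier_mat (?q + ?r) (?q + ?r)" for g
    unfolding \<rho>_def by (rule four_block_carrier_mat[OF \<sigma>(1) \<tau>(1)])
  have one: "\<rho> \<one> = 1\<^sub>m (?q + ?r)"
    using \<sigma>(3)[OF Z1] \<tau>(3)[OF Z1] by (simp add: \<rho>_def x(4) chi_one one_smult_mat)
  have "\<exists>c\<noteq>0. \<rho> g * \<rho> h = c \<cdot>\<^sub>m \<rho> (g \<otimes> h)" if gh: "g \<in> carrier G" "h \<in> carrier G" for g h
  proof -
    define a b a' b' A B where ab: "a = fst (x g)" "b = snd (x g)" "a' = fst (x h)" "b' = snd (x h)"
      "A = fst (x (g \<otimes> h))" "B = snd (x (g \<otimes> h))"
    have mem: "a \<in> H" "a' \<in> H" "A \<in> H" "b \<in> K" "b' \<in> K" "B \<in> K"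
      using x(1,2) gh by (auto simp: ab)
    then have cl: "a \<in> carrier G" "a' \<in> carrier G" "A \<in> carrier G"
      "b \<in> carrier G" "b' \<in> carrier G" "B \<in> carrier G" using HG KG by auto
    \<comment> \<open>w is the discrepancy between the factors chosen for g h and the products of
      those chosen for g and h: \<open>a a' = A w\<close> and \<open>b b' = w^-1 B\<close>. It lies
      in H and in K, hence in Z, and the inverse central characters turn it into the same factor
      \<chi> w in both blocks.\<close>
    define w where "w = inv A \<otimes> (a \<otimes> a')"
    have wG: "w \<in> carrier G" using cl by (simp add: w_def)
    have aa: "a \<otimes> a' = A \<otimes> w" using cl by (simp add: w_def flip: m_assoc)
    have "A \<otimes> B = g \<otimes> h" using x(3)[of "g \<otimes> h"] gh by (simp add: ab)
    also have "\<dots> = a \<otimes> (b \<otimes> a') \<otimes> b'"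
    proof -
      have "g = a \<otimes> b" unfolding ab by (rule x(3)) (rule gh)
      moreover have "h = a' \<otimes> b'" unfolding ab by (rule x(3)) (rule gh)
      ultimately show ?thesis using cl by (simp add: m_assoc)
    qed
    also have "\<dots> = a \<otimes> a' \<otimes> (b \<otimes> b')"
      using HK[of a' b] mem cl by (simp add: m_assoc flip: HK)
    also have "\<dots> = A \<otimes> (w \<otimes> (b \<otimes> b'))" using aa cl wG by (simp add: m_assoc)
    finally have B: "B = w \<otimes> (b \<otimes> b')" using cl wG by simp
    then have bb: "b \<otimes> b' = inv w \<otimes> B" using cl wG by (simp flip: m_assoc)
    have "w \<in> H" using mem H(1) by (simp add: w_def subgroup.m_closed subgroup.m_inv_closed)
    moreover have "w = B \<otimes> inv (b \<otimes> b')" using B cl wG by (simp add: m_assoc)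
    then have "w \<in> K" using mem K(1) by (simp add: subgroup.m_closed subgroup.m_inv_closed)
    ultimately have wZ: "w \<in> Z" using K(3) by (auto simp: H_def)
    have iwZ: "inv w \<in> Z" using wZ subgroup_Z by (simp add: subgroup.m_inv_closed)
    have chi_inv: "inverse (\<chi> (inv w)) = \<chi> w"
      using chi_mult[OF wZ iwZ] wG chi_one by (simp add: inverse_unique mult.commute)
    have s: "\<sigma> a * \<sigma> a' = \<chi> w \<cdot>\<^sub>m \<sigma> A"
    proof -
      have "\<sigma> a * \<sigma> a' = \<sigma> A * \<sigma> w" using \<sigma>(2) mem \<open>w \<in> H\<close> aa by metis
      then show ?thesis using \<sigma>(3)[OF wZ] \<sigma>(1)[of A]
          mult_smult_distrib[OF \<sigma>(1) one_carrier_mat, of A "\<chi> w"] by simp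
    qed
    have t: "\<tau> b * \<tau> b' = \<chi> w \<cdot>\<^sub>m \<tau> B"
    proof -
      have "\<tau> b * \<tau> b' = \<tau> (inv w) * \<tau> B" using \<tau>(2) mem iwZ K(2) bb by (metis subsetD)
      then show ?thesis using \<tau>(3)[OF iwZ] \<tau>(1)[of B] chi_inv
          mult_smult_assoc_mat[OF one_carrier_mat \<tau>(1), of "\<chi> w" B] by simp
    qed
    have "\<rho> g * \<rho> h = four_block_mat (\<sigma> a * \<sigma> a') (0\<^sub>m ?q ?r) (0\<^sub>m ?r ?q) (\<tau> b * \<tau> b')"
      unfolding \<rho>_def ab [symmetric]
      by (subst mult_four_block_mat[OF \<sigma>(1) zero_carrier_mat zero_carrier_mat \<tau>(1) \<sigma>(1) zero_carrier_mat zero_carrier_mat \<tau>(1)])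
         (use \<sigma>(1)[of a] \<sigma>(1)[of a'] \<tau>(1)[of b] \<tau>(1)[of b'] in simp)
    also have "\<dots> = \<chi> w \<cdot>\<^sub>m \<rho> (g \<otimes> h)"
      unfolding \<rho>_def ab [symmetric] s t
      by (subst smult_four_block_mat[OF \<sigma>(1) zero_carrier_mat zero_carrier_mat \<tau>(1)]) simp
    finally show ?thesis using chi_nonzero[OF wZ] by blast
  qed
  then have proj: "proj_rep G (?q + ?r) \<rho>" using p0 by (intro proj_repI carr one) auto
  have "faithful_proj G (?q + ?r) \<rho>"
    unfolding faithful_proj_def
  proof (intro ballI impI)
    fix g assume g: "g \<in> carrier G" and "is_scalar_mat (?q + ?r) (\<rho> g)"
    then obtain c where c: "\<rho> g = c \<cdot>\<^sub>m 1\<^sub>m (?q + ?r)" by (auto simp: is_scalar_mat_def)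
    let ?a = "fst (x g)" and ?b = "snd (x g)"
    have dims: "dim_row (\<sigma> ?a) = ?q" "dim_col (\<sigma> ?a) = ?q" "dim_row (\<tau> ?b) = ?r" "dim_col (\<tau> ?b) = ?r"
      using \<sigma>(1)[of ?a] \<tau>(1)[of ?b] by auto
    have s: "\<sigma> ?a = c \<cdot>\<^sub>m 1\<^sub>m ?q"
    proof (rule eq_matI)
      fix i j assume "i < dim_row (c \<cdot>\<^sub>m 1\<^sub>m ?q)" "j < dim_col (c \<cdot>\<^sub>m 1\<^sub>m ?q)"
      then show "\<sigma> ?a $$ (i, j) = (c \<cdot>\<^sub>m 1\<^sub>m ?q) $$ (i, j)"
        using arg_cong[OF c, of "\<lambda>M. M $$ (i, j)"] by (simp add: \<rho>_def dims)
    qed (simp_all add: dims)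
    have t: "\<tau> ?b = c \<cdot>\<^sub>m 1\<^sub>m ?r"
    proof (rule eq_matI)
      fix i j assume "i < dim_row (c \<cdot>\<^sub>m 1\<^sub>m ?r)" "j < dim_col (c \<cdot>\<^sub>m 1\<^sub>m ?r)"
      then show "\<tau> ?b $$ (i, j) = (c \<cdot>\<^sub>m 1\<^sub>m ?r) $$ (i, j)"
        using arg_cong[OF c, of "\<lambda>M. M $$ (?q + i, ?q + j)"] by (simp add: \<rho>_def dims)
    qed (simp_all add: dims)
    have ab: "?a \<in> Z" "?b \<in> Z"
      using s t \<sigma>(4)[OF x(1)[OF g]] \<tau>(4)[OF x(2)[OF g]] by (auto simp: is_scalar_mat_def)
    \<comment> \<open>The blocks share the scalar c, so the inverse characters give \<chi> the value
      1 on the product, which is g.\<close>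
    have "\<chi> ?a = c" "inverse (\<chi> ?b) = c"
      using s t \<sigma>(3)[OF ab(1)] \<tau>(3)[OF ab(2)] p0 smult_one_mat_inject by (metis zero_less_power)+
    then have "\<chi> (?a \<otimes> ?b) = 1" using chi_mult[OF ab] chi_nonzero[OF ab(2)] by (metis left_inverse)
    then have "?a \<otimes> ?b = \<one>" using chi_faithful subgroup.m_closed[OF subgroup_Z ab] by blast
    then show "g = \<one>" using x(3)[OF g] by simp
  qed
  with proj show ?thesis by blast
qed

end

section \<open>Projective actions\<close>

context complex_vector_space
begin

text \<open>Every vector of V is a sum of eigenvectors, so a single eigenvalue would make f a scalar
  on V.\<close>

lemma two_eigenvalues:
  assumes lin: "Vector_Spaces.linear scale scale f"
    and V: "subspace V" "f ` V \<subseteq> V"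
    and N: "N > 0" "\<And>v. v \<in> V \<Longrightarrow> \<exists>c\<noteq>0. (f ^^ N) v = c *s v"
    and nonscalar: "\<nexists>l. \<forall>v\<in>V. f v = l *s v"
  shows "\<exists>l1 l2 v1 v2. l1 \<noteq> l2 \<and> v1 \<in> V \<and> v2 \<in> V \<and> v1 \<noteq> 0 \<and> v2 \<noteq> 0 \<and>
    f v1 = l1 *s v1 \<and> f v2 = l2 *s v2"
proof (rule ccontr)
  assume contr: "\<not> ?thesis"
  interpret f: Vector_Spaces.linear scale scale f by (rule lin)
  have decomp: "\<exists>e l. v = (\<Sum>j<N. e j) \<and> (\<forall>j. e j \<in> V \<and> f (e j) = l j *s e j)" if v: "v \<in> V" for v
  proof -
    obtain c where c: "c \<noteq> 0" "(f ^^ N) v = c *s v" using N(2)[OF v] by blast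
    show ?thesis by (rule eigenvector_decomposition[OF lin V v c(2) N(1) c(1)]) blast
  qed
  obtain v0 where v0: "v0 \<in> V" "v0 \<noteq> 0"
    using nonscalar by (metis f.zero scale_zero_right)
  obtain e l where e: "v0 = (\<Sum>j<N. e j)" "\<forall>j. e j \<in> V \<and> f (e j) = l j *s e j"
    using decomp[OF v0(1)] by blast
  then obtain j where j: "e j \<noteq> 0" using v0(2) by (metis sum.neutral)
  have "f v = l j *s v" if v: "v \<in> V" for v
  proof -
    obtain e' l' where e': "v = (\<Sum>k<N. e' k)" "\<forall>k. e' k \<in> V \<and> f (e' k) = l' k *s e' k"
      using decomp[OF v] by blast
    have "f (e' k) = l j *s e' k" for k
    proof (cases "e' k = 0")
      case False
      then have "l' k = l j" using contr e(2) e'(2) j by blast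
      then show ?thesis using e'(2) by simp
    qed (simp add: f.zero)
    then show ?thesis by (simp add: e'(1) f.sum scale_sum_right)
  qed
  with nonscalar show False by blast
qed

lemma independent_family_two_eigenspaces:
  assumes lin: "Vector_Spaces.linear scale scale f" and "l1 \<noteq> l2" and fin: "finite I" "finite J"
    and u: "independent_family I u" "\<And>i. i \<in> I \<Longrightarrow> f (u i) = l1 *s u i"
    and w: "independent_family J w" "\<And>j. j \<in> J \<Longrightarrow> f (w j) = l2 *s w j"
  shows "independent_family (I <+> J) (case_sum u w)"
  unfolding independent_family_def
proof (intro allI impI)
  interpret f: Vector_Spaces.linear scale scale f by (rule lin)
  fix k assume "(\<Sum>x\<in>I <+> J. k x *s case_sum u w x) = 0"
  moreover define a b where "a = (\<Sum>i\<in>I. k (Inl i) *s u i)" and "b = (\<Sum>j\<in>J. k (Inr j) *s w j)"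
  ultimately have ab: "a + b = 0" using fin by (simp add: sum.Plus)
  have fa: "f a = l1 *s a"
    unfolding a_def f.sum scale_sum_right
    by (intro sum.cong refl) (simp add: f.scale u(2) mult.commute)
  have fb: "f b = l2 *s b"
    unfolding b_def f.sum scale_sum_right
    by (intro sum.cong refl) (simp add: f.scale w(2) mult.commute)
  have "a = - b" using ab by (simp add: eq_neg_iff_add_eq_0)
  have "l1 *s a + l2 *s b = 0" using f.add[of a b] ab fa fb f.zero by simp
  then have "(l2 - l1) *s b = 0" unfolding \<open>a = - b\<close> by (simp add: scale_left_diff_distrib)
  then have "b = 0" using \<open>l1 \<noteq> l2\<close> by simp
  then have "a = 0" using ab by simp
  with \<open>b = 0\<close> show "\<forall>x\<in>I <+> J. k x = 0"
    using u(1) w(1) unfolding independent_family_def a_def b_def by auto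
qed

end

text \<open>The operators act on an ambient space while the group relations are required on W only.
  Restricting to an invariant subspace thus changes one parameter and keeps \<open>T\<close> and
  \<alpha>.\<close>

locale projective_action = complex_vector_space scale + group G
  for scale :: "complex \<Rightarrow> 'b::ab_group_add \<Rightarrow> 'b" (infixr "*s" 75)
    and G :: "('a, 'c) monoid_scheme" (structure) +
  fixes T :: "'a \<Rightarrow> 'b \<Rightarrow> 'b" and \<alpha> :: "'a \<Rightarrow> 'a \<Rightarrow> complex" and W :: "'b set"
  assumes finG: "finite (carrier G)"
    and linear_T: "\<And>g. Vector_Spaces.linear scale scale (T g)"
    and subspace_W: "subspace W"
    and T_closed: "\<lbrakk>g \<in> carrier G; v \<in> W\<rbrakk> \<Longrightarrow> T g v \<in> W"
    and T_one: "v \<in> W \<Longrightarrow> T \<one> v = v"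
    and T_mult: "\<lbrakk>g \<in> carrier G; h \<in> carrier G; v \<in> W\<rbrakk> \<Longrightarrow> T g (T h v) = \<alpha> g h *s T (g \<otimes> h) v"
    and alpha_nonzero: "\<lbrakk>g \<in> carrier G; h \<in> carrier G\<rbrakk> \<Longrightarrow> \<alpha> g h \<noteq> 0"
begin

lemma T_scale: "T g (c *s v) = c *s T g v"
proof -
  interpret Vector_Spaces.linear scale scale "T g" by (rule linear_T)
  show ?thesis by (rule scale)
qed

lemma T_zero: "T g 0 = 0"
  using T_scale[of g 0 0] by simp

lemma T_product: "\<lbrakk>g \<in> carrier G; h \<in> carrier G; v \<in> W\<rbrakk> \<Longrightarrow> T (g \<otimes> h) v = inverse (\<alpha> g h) *s T g (T h v)"
  by (simp add: T_mult alpha_nonzero)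

lemma T_inv_left: "\<lbrakk>g \<in> carrier G; v \<in> W\<rbrakk> \<Longrightarrow> T (inv g) (T g v) = \<alpha> (inv g) g *s v"
  by (simp add: T_mult T_one)

lemma T_inv_right: "\<lbrakk>g \<in> carrier G; v \<in> W\<rbrakk> \<Longrightarrow> T g (T (inv g) v) = \<alpha> g (inv g) *s v"
  by (simp add: T_mult T_one)

lemma T_inject: "\<lbrakk>g \<in> carrier G; u \<in> W; v \<in> W; T g u = T g v\<rbrakk> \<Longrightarrow> u = v"
  using T_inv_left[of g u] T_inv_left[of g v] alpha_nonzero[of "inv g" g]
  by (metis inv_closed scale_left_imp_eq)

lemma T_nonzero: "\<lbrakk>g \<in> carrier G; v \<in> W; v \<noteq> 0\<rbrakk> \<Longrightarrow> T g v \<noteq> 0"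
  using T_inject[of g v 0] T_zero subspace_0[OF subspace_W] by auto

lemma T_surj:
  assumes "g \<in> carrier G" "u \<in> W"
  shows "\<exists>v\<in>W. T g v = u"
proof
  let ?v = "inverse (\<alpha> g (inv g)) *s T (inv g) u"
  show "?v \<in> W" using assms T_closed subspace_W by (intro subspace_scale) auto
  show "T g ?v = u" using assms alpha_nonzero[of g "inv g"] by (simp add: T_scale T_inv_right)
qed

lemma T_power: "g \<in> carrier G \<Longrightarrow> \<exists>c\<noteq>0. \<forall>v\<in>W. (T g ^^ k) v = c *s T (g [^] k) v"
proof (induction k)
  case 0
  then show ?case using T_one by (intro exI[of _ 1]) auto
next
  case (Suc k)
  then obtain c where c: "c \<noteq> 0" "\<forall>v\<in>W. (T g ^^ k) v = c *s T (g [^] k) v" by blast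
  have "(T g ^^ Suc k) v = (c * \<alpha> g (g [^] k)) *s T (g [^] Suc k) v" if "v \<in> W" for v
  proof -
    have "(T g ^^ Suc k) v = c *s T g (T (g [^] k) v)" using c that by (simp add: T_scale)
    also have "\<dots> = (c * \<alpha> g (g [^] k)) *s T (g \<otimes> g [^] k) v" using Suc.prems that by (simp add: T_mult)
    also have "g \<otimes> g [^] k = g [^] Suc k" using Suc.prems by (metis nat_pow_Suc2)
    finally show ?thesis .
  qed
  moreover have "c * \<alpha> g (g [^] k) \<noteq> 0" using c Suc.prems alpha_nonzero by simp
  ultimately show ?case by blast
qed

lemma T_power_card:
  assumes "g \<in> carrier G" "v \<in> W"
  shows "\<exists>c\<noteq>0. (T g ^^ card (carrier G)) v = c *s v"
  using T_power[OF assms(1), of "card (carrier G)"] assms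
    pow_order_eq_1[OF assms(1), unfolded Coset.order_def] T_one by metis

text \<open>U need not be a subspace: besides a single eigenspace, it will be the union of two, on
  which the scalar has to be shared.\<close>

lemma scalar_subgroup:
  assumes U: "U \<subseteq> W" "u \<in> U" "u \<noteq> 0"
  shows "subgroup {g \<in> carrier G. \<exists>c. \<forall>v\<in>U. T g v = c *s v} G"
proof (rule subgroup.intro)
  show "\<one> \<in> {g \<in> carrier G. \<exists>c. \<forall>v\<in>U. T g v = c *s v}"
    using T_one U by (auto intro!: exI[of _ 1])
next
  fix g h
  assume "g \<in> {g \<in> carrier G. \<exists>c. \<forall>v\<in>U. T g v = c *s v}" "h \<in> {g \<in> carrier G. \<exists>c. \<forall>v\<in>U. T g v = c *s v}"
  then obtain c d where gh: "g \<in> carrier G" "h \<in> carrier G" "\<forall>v\<in>U. T g v = c *s v" "\<forall>v\<in>U. T h v = d *s v"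
    by blast
  then have "\<forall>v\<in>U. T (g \<otimes> h) v = (inverse (\<alpha> g h) * d * c) *s v"
    using U by (auto simp: T_product T_scale subset_iff)
  then show "g \<otimes> h \<in> {g \<in> carrier G. \<exists>c. \<forall>v\<in>U. T g v = c *s v}" using gh by blast
next
  fix g
  assume "g \<in> {g \<in> carrier G. \<exists>c. \<forall>v\<in>U. T g v = c *s v}"
  then obtain c where g: "g \<in> carrier G" "\<forall>v\<in>U. T g v = c *s v" by blast
  have "c \<noteq> 0" using T_nonzero[OF g(1), of u] g(2) U by auto
  have "T (inv g) v = (inverse c * \<alpha> (inv g) g) *s v" if "v \<in> U" for v
  proof -
    have "c *s T (inv g) v = \<alpha> (inv g) g *s v"
      using T_inv_left[OF g(1), of v] g(2) that U(1) by (auto simp: T_scale)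
    then have "inverse c *s c *s T (inv g) v = inverse c *s \<alpha> (inv g) g *s v" by simp
    then show ?thesis using \<open>c \<noteq> 0\<close> by simp
  qed
  then show "inv g \<in> {g \<in> carrier G. \<exists>c. \<forall>v\<in>U. T g v = c *s v}" using g by blast
qed auto

text \<open>The scalars are determined because \<open>T g (T h w)\<close> is nonzero. Moving
  \<open>T k\<close> past \<open>T (x \<otimes> y)\<close> at once or in two steps gives
  multiplicativity; the factor \<alpha> x y occurs on both sides.\<close>

lemma commutation_bicharacter:
  assumes comm: "\<And>g h v. \<lbrakk>g \<in> carrier G; h \<in> carrier G; v \<in> W\<rbrakk> \<Longrightarrow> T g (T h v) = \<beta> g h *s T h (T g v)"
    and w: "w \<in> W" "w \<noteq> 0"
  shows "alternating_bicharacter G \<beta>"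
proof unfold_locales
  have nz: "T g (T h w) \<noteq> 0" if "g \<in> carrier G" "h \<in> carrier G" for g h
    using that w by (intro T_nonzero T_closed)
  show "\<beta> (x \<otimes> y) k = \<beta> x k * \<beta> y k" if cl: "x \<in> carrier G" "y \<in> carrier G" "k \<in> carrier G" for x y k
  proof -
    have "T (x \<otimes> y) (T k w) = inverse (\<alpha> x y) *s T x (T y (T k w))"
      using cl w by (simp add: T_product T_closed)
    also have "\<dots> = inverse (\<alpha> x y) *s \<beta> y k *s \<beta> x k *s T k (T x (T y w))"
      using cl w by (simp add: comm[OF cl(2,3)] comm[OF cl(1,3)] T_scale T_closed)
    also have "\<dots> = (\<beta> x k * \<beta> y k) *s T k (T (x \<otimes> y) w)"
      using cl w by (simp add: T_product T_scale mult_ac)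
    finally have "(\<beta> (x \<otimes> y) k) *s T k (T (x \<otimes> y) w) = (\<beta> x k * \<beta> y k) *s T k (T (x \<otimes> y) w)"
      using comm[of "x \<otimes> y" k w] cl w by simp
    then show ?thesis using nz[of k "x \<otimes> y"] cl by simp
  qed
  show "\<beta> x x = 1" if "x \<in> carrier G" for x
    using comm[of x x w] nz[of x x] that w by (metis scale_cancel_right scale_one)
  show "\<beta> x y * \<beta> y x = 1" if "x \<in> carrier G" "y \<in> carrier G" for x y
  proof -
    have "T x (T y w) = \<beta> x y *s \<beta> y x *s T x (T y w)"
      using comm[of x y w] comm[of y x w] that w by simp
    then show ?thesis using nz[OF that] by (metis scale_cancel_right scale_one scale_scale)
  qed
qed (rule finG)

text \<open>A common eigenvector \<open>v\<close> of a Lagrangian \<open>A\<close> is moved by the cosets of \<open>A\<close> to eigenvectors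
  for pairwise distinct characters of \<open>A\<close>.\<close>

lemma independent_orbit:
  assumes comm: "\<And>g h v. \<lbrakk>g \<in> carrier G; h \<in> carrier G; v \<in> W\<rbrakk> \<Longrightarrow> T g (T h v) = \<beta> g h *s T h (T g v)"
    and w: "w \<in> W" "w \<noteq> 0"
  shows "\<exists>A N u. subgroup A G \<and>
    card A ^ 2 = card (carrier G) * card (alternating_bicharacter.perp G \<beta> (carrier G)) \<and>
    card (carrier G) = N * card A \<and> u ` {..<N::nat} \<subseteq> W \<and> independent_family {..<N} u"
proof -
  interpret b: alternating_bicharacter G \<beta> by (rule commutation_bicharacter[OF comm w])
  obtain A where A: "subgroup A G" "A \<subseteq> carrier G" "b.isotropic A" "carrier G \<inter> b.perp A = A"
    "card A ^ 2 = card (carrier G) * card (carrier G \<inter> b.perp (carrier G))"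
    using b.lagrangian_exists[OF subgroup_self] by blast
  have finA: "finite A" using A(2) finG finite_subset by blast
  \<comment> \<open>On an isotropic subgroup the operators commute exactly and not merely up to a
    scalar.\<close>
  have "\<exists>v\<in>W. v \<noteq> 0 \<and> (\<exists>\<psi>. \<forall>a\<in>A. T a v = \<psi> a *s v)"
  proof (rule common_eigenvector[OF finA subspace_W w linear_T])
    show "T a ` W \<subseteq> W" if "a \<in> A" for a using that A(2) T_closed by blast
    show "T a (T b v) = T b (T a v)" if "a \<in> A" "b \<in> A" "v \<in> W" for a b v
    proof -
      have "\<beta> a b = 1" using A(3) that by (auto simp: b.isotropic_def)
      moreover have "a \<in> carrier G" "b \<in> carrier G" using that A(2) by auto
      ultimately show ?thesis using comm[of a b v] that by simp
    qed
    show "\<exists>N>0. \<exists>c\<noteq>0. (T a ^^ N) v = c *s v" if "a \<in> A" "v \<in> W" for a v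
      using T_power_card[of a v] that A(2) finG
      by (intro exI[of _ "card (carrier G)"]) (auto simp: card_gt_0_iff)
  qed
  then obtain v \<psi> where v: "v \<in> W" "v \<noteq> 0" "\<forall>a\<in>A. T a v = \<psi> a *s v" by blast
  obtain N t where N: "card (carrier G) = N * card A" and t: "\<forall>i<N. t i \<in> carrier G"
    and trans: "\<forall>h\<in>carrier G. \<exists>!i. i < N \<and> h \<otimes> inv (t i) \<in> A"
    using subgroup_transversal[OF finG A(1) subgroup_self A(2)] by (elim exE conjE) (rule that)
  have psi: "\<psi> a \<noteq> 0" if "a \<in> A" for a
  proof
    assume "\<psi> a = 0"
    then have "T a v = 0" using v that by simp
    then show False using T_nonzero[of a v] v that A(2) by auto
  qed
  have ind: "independent_family {..<N} (\<lambda>i. T (t i) v)"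
  proof (rule independent_family_eigenvectors[where S = A and T = T and \<phi> = "\<lambda>i a. \<beta> a (t i) * \<psi> a"])
    show "T a (T (t i) v) = (\<beta> a (t i) * \<psi> a) *s T (t i) v" if "i \<in> {..<N}" "a \<in> A" for i a
      using comm[of a "t i" v] that t A(2) v by (auto simp: T_scale subset_iff)
    show "T (t i) v \<noteq> 0" if "i \<in> {..<N}" for i using T_nonzero[of "t i" v] v t that by auto
    \<comment> \<open>Equal characters would put \<open>t i \<otimes> inv (t j)\<close> into
      \<open>perp A\<close>, which is A, so two representatives would share a coset.\<close>
    show "\<exists>a\<in>A. \<beta> a (t i) * \<psi> a \<noteq> \<beta> a (t j) * \<psi> a" if ij: "i \<in> {..<N}" "j \<in> {..<N}" "i \<noteq> j" for i j
    proof (rule ccontr)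
      assume contr: "\<not> ?thesis"
      have tt: "t i \<in> carrier G" "t j \<in> carrier G" using t ij by auto
      have "\<beta> (t i \<otimes> inv (t j)) a = 1" if a: "a \<in> A" for a
      proof -
        have aG: "a \<in> carrier G" using a A(2) by blast
        have "\<beta> a (t i) = \<beta> a (t j)" using contr a psi by auto
        moreover have "\<beta> a (t i \<otimes> inv (t j)) = \<beta> a (t i) * inverse (\<beta> a (t j))"
          using aG tt by (simp add: b.mult_right b.inv_right)
        ultimately have "\<beta> a (t i \<otimes> inv (t j)) = 1"
          using b.nonzero[OF aG tt(2)] by simp
        then show ?thesis
          using b.eq_1_commute[OF aG m_closed[OF tt(1) inv_closed[OF tt(2)]]] by blast
      qed
      then have "t i \<otimes> inv (t j) \<in> carrier G \<inter> b.perp A" using tt by (simp add: b.perp_def)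
      then have "t i \<otimes> inv (t j) \<in> A" using A(4) by simp
      moreover have "t i \<otimes> inv (t i) \<in> A" using tt A(1) by (simp add: subgroup.one_closed)
      ultimately show False using trans tt(1) ij by blast
    qed
  qed (auto intro: linear_T)
  have "carrier G \<inter> b.perp (carrier G) = b.perp (carrier G)" by (auto simp: b.perp_def)
  moreover have "(\<lambda>i. T (t i) v) ` {..<N} \<subseteq> W" using t v T_closed by auto
  ultimately show ?thesis using A(1,5) N ind by (intro exI[of _ A] exI[of _ N]) auto
qed

end

text \<open>An instance of the product formula for subgroups, |R| |R'| \<le> |G| |R \<inter> R'|; R
  will be the radical of the bicharacter on the other eigenspace.\<close>

lemma (in alternating_bicharacter) card_radical_inter:
  assumes R: "subgroup R G"
  shows "card R * card (perp (carrier G)) \<le> card (carrier G) * card (R \<inter> perp (carrier G))"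
proof -
  have "perp (carrier G) \<subseteq> carrier G \<inter> perp R"
    using subgroup.subset[OF R] by (auto simp: perp_def)
  then have "card R * card (perp (carrier G)) \<le> card R * card (carrier G \<inter> perp R)"
    using finite_carrier by (intro mult_le_mono2 card_mono) auto
  then show ?thesis using card_perp_symmetric[OF R subgroup_self] by simp
qed

section \<open>Projective actions of extra-special groups\<close>

text \<open>Balanced exponents are best. If the smaller one drops below \<open>n div 2\<close>, the
  larger one exceeds \<open>n - n div 2\<close>, and its power alone outweighs the balanced sum
  because p \<ge> 2.\<close>

lemma prime_power_sum_ge:
  fixes p :: nat
  assumes "p \<ge> 2" "n \<le> a + b"
  shows "p ^ (n - n div 2) + p ^ (n div 2) \<le> p ^ a + p ^ b"
proof -
  have *: "p ^ (n - n div 2) + p ^ (n div 2) \<le> p ^ a + p ^ b" if "a \<le> b" "n \<le> a + b" for a b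
  proof (cases "n div 2 \<le> a")
    case True
    show ?thesis
    proof (cases "n - n div 2 \<le> b")
      case True
      then show ?thesis using \<open>n div 2 \<le> a\<close> \<open>p \<ge> 2\<close>
        by (subst add.commute) (intro add_mono power_increasing; simp)
    next
      case False
      \<comment> \<open>Contradictory case: \<open>n div 2 \<le> a \<le> b < n - n div 2\<close>
        would give a + b < n.\<close>
      then show ?thesis using that \<open>n div 2 \<le> a\<close> by linarith
    qed
  next
    case False
    then have b: "Suc (n - n div 2) \<le> b" using that by linarith
    have "p ^ (n - n div 2) + p ^ (n div 2) \<le> p ^ (n - n div 2) + p ^ (n - n div 2)"
      using \<open>p \<ge> 2\<close> by (intro add_left_mono power_increasing) auto
    also have "\<dots> \<le> p * p ^ (n - n div 2)"
      using mult_le_mono1[OF \<open>p \<ge> 2\<close>, of "p ^ (n - n div 2)"] by (simp only: mult_2)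
    also have "\<dots> \<le> p ^ b" using power_increasing[OF b, of p] \<open>p \<ge> 2\<close> by simp
    finally show ?thesis by simp
  qed
  show ?thesis
  proof (cases "a \<le> b")
    case False
    then show ?thesis using *[of b a] assms by (simp add: add.commute)
  qed (use * assms in blast)
qed

locale extra_special_action =
  extra_special_character G p \<chi> + projective_action scale G T \<alpha> V
  for G :: "('a, 'c) monoid_scheme" (structure) and p \<chi>
    and scale :: "complex \<Rightarrow> 'b::ab_group_add \<Rightarrow> 'b" (infixr "*s" 75)
    and T \<alpha> V +
  fixes n :: nat
  assumes card_G: "card (carrier G) = p ^ (2 * n + 1)" and n_gt_1: "n > 1"
    and faithful: "\<lbrakk>g \<in> carrier G; g \<noteq> \<one>; \<forall>v\<in>V. T g v = l *s v\<rbrakk> \<Longrightarrow> False"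
begin

text \<open>k collects three cocycle values and is the same for all v; this uniformity allows
  scalars on two eigenspaces to be compared.\<close>

lemma commutator_action:
  assumes "x \<in> carrier G" "y \<in> carrier G"
  shows "\<exists>k\<noteq>0. \<forall>v\<in>V. T x (T y v) = k *s T (comm x y) (T y (T x v))"
proof (intro exI conjI ballI)
  let ?c = "comm x y"
  have c: "?c \<in> carrier G" using assms by (rule comm_closed)
  let ?k = "\<alpha> x y * inverse (\<alpha> ?c (y \<otimes> x)) * inverse (\<alpha> y x)"
  show "?k \<noteq> 0" using alpha_nonzero assms c by simp
  show "T x (T y v) = ?k *s T ?c (T y (T x v))" if "v \<in> V" for v
  proof -
    have "T x (T y v) = \<alpha> x y *s T (?c \<otimes> (y \<otimes> x)) v"
      using that assms comm_mult[OF assms] by (simp add: T_mult)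
    also have "\<dots> = \<alpha> x y *s inverse (\<alpha> ?c (y \<otimes> x)) *s T ?c (T (y \<otimes> x) v)"
      using that assms c T_product[of ?c "y \<otimes> x" v] by simp
    also have "T (y \<otimes> x) v = inverse (\<alpha> y x) *s T y (T x v)"
      using that assms by (simp add: T_product)
    finally show ?thesis by (simp add: T_scale)
  qed
qed

text \<open>The elements whose operators commute with \<open>T g\<close> form a subgroup, so one
  nontrivial central element suffices. It is a commutator of two elements x, y centralising g:
  \<open>T g\<close> commutes with \<open>T x\<close> and \<open>T y\<close> up to scalars, and
  these cancel in the commutator.\<close>

lemma center_commutes:
  assumes z: "z \<in> Z" and g: "g \<in> carrier G" and v: "v \<in> V"
  shows "T z (T g v) = T g (T z v)"
proof -
  define C where "C = {w \<in> carrier G. \<forall>v\<in>V. T w (T g v) = T g (T w v)}"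
  have C: "subgroup C G"
  proof (rule subgroup.intro)
    show "\<one> \<in> C" using g by (simp add: C_def T_one T_closed)
    show "x \<otimes> y \<in> C" if "x \<in> C" "y \<in> C" for x y
      using that g by (auto simp: C_def T_product T_scale T_closed)
    show "inv x \<in> C" if x: "x \<in> C" for x
    proof -
      have xG: "x \<in> carrier G" using x by (simp add: C_def)
      have "T (inv x) (T g v) = T g (T (inv x) v)" if v: "v \<in> V" for v
      proof (rule T_inject[OF xG])
        have "T x (T g (T (inv x) v)) = T g (T x (T (inv x) v))"
          using x v xG T_closed[of "inv x" v] by (simp add: C_def)
        also have "\<dots> = \<alpha> x (inv x) *s T g v" using xG v by (simp add: T_inv_right T_scale)
        also have "\<dots> = T x (T (inv x) (T g v))" using xG v g by (simp add: T_inv_right T_closed)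
        finally show "T x (T (inv x) (T g v)) = T x (T g (T (inv x) v))" ..
      qed (use xG g v in \<open>auto intro!: T_closed\<close>)
      then show ?thesis using xG by (simp add: C_def)
    qed
  qed (auto simp: C_def)
  obtain x y where xy: "x \<in> carrier G" "y \<in> carrier G" "g \<otimes> x = x \<otimes> g" "g \<otimes> y = y \<otimes> g"
    "comm x y \<noteq> \<one>"
    by (rule centraliser_nonabelian[OF card_G n_gt_1 g])
  have swap: "\<exists>k\<noteq>0. \<forall>v\<in>V. T g (T x v) = k *s T x (T g v)"
    if x: "x \<in> carrier G" "g \<otimes> x = x \<otimes> g" for x
  proof (intro exI conjI ballI)
    show "\<alpha> g x * inverse (\<alpha> x g) \<noteq> 0" using alpha_nonzero x(1) g by simp
    show "T g (T x v) = (\<alpha> g x * inverse (\<alpha> x g)) *s T x (T g v)" if "v \<in> V" for v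
      using that x g alpha_nonzero[of x g] by (simp add: T_mult)
  qed
  obtain kx where kx: "kx \<noteq> 0" "\<And>v. v \<in> V \<Longrightarrow> T g (T x v) = kx *s T x (T g v)"
    using swap xy by blast
  obtain ky where ky: "ky \<noteq> 0" "\<And>v. v \<in> V \<Longrightarrow> T g (T y v) = ky *s T y (T g v)"
    using swap xy by blast
  let ?c = "comm x y"
  obtain k where k: "k \<noteq> 0" "\<And>v. v \<in> V \<Longrightarrow> T x (T y v) = k *s T ?c (T y (T x v))"
    using commutator_action[OF xy(1,2)] by blast
  have c: "?c \<in> carrier G" using xy by (intro comm_closed)
  \<comment> \<open>With u written as \<open>T y (T x v)\<close>, moving \<open>T g\<close> past
    \<open>T x (T y v)\<close> and past \<open>T y (T x v)\<close> costs \<open>kx * ky\<close> both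
    times, and only k is left to cancel.\<close>
  have "T ?c (T g u) = T g (T ?c u)" if u: "u \<in> V" for u
  proof -
    obtain u' where u': "u' \<in> V" "T y u' = u" using T_surj[OF xy(2) u] by blast
    obtain v where v: "v \<in> V" "T x v = u'" using T_surj[OF xy(1) u'(1)] by blast
    have "k *s T g (T ?c u) = T g (T x (T y v))"
      using k(2)[OF v(1)] u' v by (simp add: T_scale)
    also have "\<dots> = (kx * ky) *s T x (T y (T g v))"
      using kx(2) ky(2) v xy g by (simp add: T_closed T_scale mult.commute)
    also have "\<dots> = (kx * ky * k) *s T ?c (T y (T x (T g v)))"
      using k(2) v g by (simp add: T_closed)
    also have "\<dots> = k *s T ?c (ky *s kx *s T y (T x (T g v)))"
      by (simp add: T_scale mult_ac)
    also have "ky *s kx *s T y (T x (T g v)) = T g (T y (T x v))"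
      by (simp add: ky(2)[OF T_closed[OF xy(1) v(1)]] kx(2)[OF v(1)] T_scale)
    also have "T y (T x v) = u" using u' v by simp
    finally show ?thesis using k(1) by simp
  qed
  then have "?c \<in> C" using c by (simp add: C_def)
  then have "Z \<subseteq> C" using Z_subset_subgroup[OF C comm_in_Z[OF xy(1,2)]] xy(5) by blast
  then show ?thesis using z v by (auto simp: C_def)
qed

definition eigenspace :: "'a \<Rightarrow> complex \<Rightarrow> 'b set" where
  "eigenspace z l = {v \<in> V. T z v = l *s v}"

lemma eigenspace_action:
  assumes "z \<in> Z"
  shows "projective_action scale G T \<alpha> (eigenspace z l)"
proof (intro projective_action.intro projective_action_axioms.intro)
  show "complex_vector_space scale" "group G" by unfold_locales
  show "subspace (eigenspace z l)"
  proof -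
    interpret t: Vector_Spaces.linear scale scale "T z" by (rule linear_T)
    show ?thesis using subspace_W unfolding eigenspace_def subspace_def
      by (auto simp: t.add t.scale t.zero scale_right_distrib mult.commute)
  qed
  show "T g v \<in> eigenspace z l" if "g \<in> carrier G" "v \<in> eigenspace z l" for g v
    using that center_commutes[OF assms] by (auto simp: eigenspace_def T_closed T_scale)
qed (auto simp: eigenspace_def finG linear_T T_one T_mult alpha_nonzero)

lemma center_two_eigenvalues:
  obtains z l1 l2 v1 v2 where "z \<in> Z" "z \<noteq> \<one>" "l1 \<noteq> l2"
    "v1 \<in> eigenspace z l1" "v1 \<noteq> 0" "v2 \<in> eigenspace z l2" "v2 \<noteq> 0"
proof -
  obtain z where z: "z \<in> Z" "z \<noteq> \<one>" by (rule Z_nontrivial)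
  have zG: "z \<in> carrier G" using z by (simp add: Z_closed)
  have "\<exists>l1 l2 v1 v2. l1 \<noteq> l2 \<and> v1 \<in> V \<and> v2 \<in> V \<and> v1 \<noteq> 0 \<and> v2 \<noteq> 0 \<and>
    T z v1 = l1 *s v1 \<and> T z v2 = l2 *s v2"
  proof (rule two_eigenvalues[OF linear_T subspace_W])
    show "T z ` V \<subseteq> V" using zG T_closed by blast
    show "0 < card (carrier G)" using finG by (auto simp: card_gt_0_iff)
    show "\<exists>c\<noteq>0. (T z ^^ card (carrier G)) v = c *s v" if "v \<in> V" for v
      using T_power_card[OF zG that] .
    show "\<nexists>l. \<forall>v\<in>V. T z v = l *s v" using faithful[OF zG z(2)] by blast
  qed
  then show thesis using that z by (auto simp: eigenspace_def)
qed

lemma proper_invariant_subspace: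
  "\<exists>W. subspace W \<and> W \<subseteq> V \<and> (\<forall>g\<in>carrier G. \<forall>v\<in>W. T g v \<in> W) \<and> (\<exists>v\<in>W. v \<noteq> 0) \<and> W \<noteq> V"
proof -
  obtain z l1 l2 v1 v2 where z: "z \<in> Z" "z \<noteq> \<one>" "l1 \<noteq> l2"
    "v1 \<in> eigenspace z l1" "v1 \<noteq> 0" "v2 \<in> eigenspace z l2" "v2 \<noteq> 0"
    by (rule center_two_eigenvalues)
  interpret E: projective_action scale G T \<alpha> "eigenspace z l1" by (rule eigenspace_action[OF z(1)])
  have "v2 \<notin> eigenspace z l1" using z by (auto simp: eigenspace_def)
  moreover have "v2 \<in> V" using z by (simp add: eigenspace_def)
  ultimately show ?thesis
    using E.subspace_W E.T_closed z(4,5) by (intro exI[of _ "eigenspace z l1"]) (auto simp: eigenspace_def)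
qed

text \<open>z is a scalar on its own eigenspace, hence so is all of Z, and in particular the
  operator of \<open>comm g h\<close> in the commutation relation.\<close>

lemma eigenspace_bicharacter:
  assumes z: "z \<in> Z" "z \<noteq> \<one>" and w: "w \<in> eigenspace z l" "w \<noteq> 0"
  obtains \<beta>' where "\<And>g h v. \<lbrakk>g \<in> carrier G; h \<in> carrier G; v \<in> eigenspace z l\<rbrakk> \<Longrightarrow>
    T g (T h v) = \<beta>' g h *s T h (T g v)"
proof -
  interpret E: projective_action scale G T \<alpha> "eigenspace z l" by (rule eigenspace_action[OF z(1)])
  have "z \<in> {g \<in> carrier G. \<exists>c. \<forall>v\<in>eigenspace z l. T g v = c *s v}"
    using z Z_closed by (auto simp: eigenspace_def)
  then have scalar: "Z \<subseteq> {g \<in> carrier G. \<exists>c. \<forall>v\<in>eigenspace z l. T g v = c *s v}"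
    using Z_subset_subgroup[OF E.scalar_subgroup[OF subset_refl w] z(1)] z(2) by blast
  have "\<exists>b. \<forall>v\<in>eigenspace z l. T g (T h v) = b *s T h (T g v)"
    if gh: "g \<in> carrier G" "h \<in> carrier G" for g h
  proof -
    obtain k where k: "\<And>v. v \<in> V \<Longrightarrow> T g (T h v) = k *s T (comm g h) (T h (T g v))"
      using commutator_action[OF gh] by blast
    obtain c where c: "\<forall>v\<in>eigenspace z l. T (comm g h) v = c *s v"
      using comm_in_Z[OF gh] scalar by blast
    have "T g (T h v) = (k * c) *s T h (T g v)" if v: "v \<in> eigenspace z l" for v
      using k[of v] c E.T_closed[OF gh(2) E.T_closed[OF gh(1) v]] v by (simp add: eigenspace_def)
    then show ?thesis by blast
  qed
  then obtain \<beta>' where "\<forall>g\<in>carrier G. \<forall>h\<in>carrier G. \<forall>v\<in>eigenspace z l. T g (T h v) = \<beta>' g h *s T h (T g v)"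
    by metis
  then show thesis using that by blast
qed

text \<open>If \<open>comm g h\<close> were nontrivial, it would act on both eigenspaces by the same
  scalar \<open>inverse k\<close>. It generates Z, so z would act by one scalar on both, against l1
  \<noteq> l2.\<close>

lemma radicals_meet_in_center:
  assumes z: "z \<in> Z" "z \<noteq> \<one>" "l1 \<noteq> l2"
    and v: "v1 \<in> eigenspace z l1" "v1 \<noteq> 0" "v2 \<in> eigenspace z l2" "v2 \<noteq> 0"
    and g: "g \<in> carrier G"
    and comm: "\<And>h v. \<lbrakk>h \<in> carrier G; v \<in> eigenspace z l1 \<union> eigenspace z l2\<rbrakk> \<Longrightarrow> T g (T h v) = T h (T g v)"
  shows "g \<in> Z"
proof -
  let ?U = "eigenspace z l1 \<union> eigenspace z l2"
  have UV: "?U \<subseteq> V" by (auto simp: eigenspace_def)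
  have surj: "\<exists>v\<in>?U. T x v = u" if "x \<in> carrier G" "u \<in> ?U" for x u
    using projective_action.T_surj[OF eigenspace_action[OF z(1)] that(1)] that(2) by blast
  have "g \<otimes> h = h \<otimes> g" if h: "h \<in> carrier G" for h
  proof (rule ccontr)
    assume "g \<otimes> h \<noteq> h \<otimes> g"
    then have c1: "comm g h \<noteq> \<one>" using comm_eq_one g h by blast
    obtain k where k: "k \<noteq> 0" "\<And>v. v \<in> V \<Longrightarrow> T g (T h v) = k *s T (comm g h) (T h (T g v))"
      using commutator_action[OF g h] by blast
    have "T (comm g h) u = inverse k *s u" if u: "u \<in> ?U" for u
    proof -
      obtain u' where u': "u' \<in> ?U" "T h u' = u" using surj[OF h u] by blast
      obtain v where v: "v \<in> ?U" "T g v = u'" using surj[OF g u'(1)] by blast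
      have "u = k *s T (comm g h) u" using k(2)[of v] comm[OF h v(1)] v u' UV by auto
      then have "inverse k *s u = inverse k *s k *s T (comm g h) u" by simp
      then show ?thesis using k(1) by simp
    qed
    then have c: "comm g h \<in> {g \<in> carrier G. \<exists>c. \<forall>v\<in>?U. T g v = c *s v}"
      using comm_closed[OF g h] by blast
    have v1U: "v1 \<in> ?U" using v by blast
    have "Z \<subseteq> {g \<in> carrier G. \<exists>c. \<forall>v\<in>?U. T g v = c *s v}"
      by (rule Z_subset_subgroup[OF scalar_subgroup[OF UV v1U v(2)] comm_in_Z[OF g h] c c1])
    then obtain d where d: "\<forall>v\<in>?U. T z v = d *s v" using z(1) by blast
    have "T z v1 = d *s v1" "T z v2 = d *s v2" using d v by blast+
    moreover have "T z v1 = l1 *s v1" "T z v2 = l2 *s v2" using v by (simp_all add: eigenspace_def)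
    ultimately show False using v(2,4) z(3) by (metis scale_right_imp_eq)
  qed
  then show ?thesis using g by (simp add: group_center_def)
qed

text \<open>Each eigenspace contains an independent orbit whose size is the index of a Lagrangian,
  and the two orbits stay independent together because their eigenvalues under z differ.\<close>

lemma degree_lower_bound:
  assumes B: "finite B" "V \<subseteq> span B"
  shows "p ^ (n - n div 2) + p ^ (n div 2) \<le> card B"
proof -
  have p2: "p \<ge> 2" using prime_ge_2_nat[OF prime_p] .
  obtain z l1 l2 v1 v2 where z: "z \<in> Z" "z \<noteq> \<one>" "l1 \<noteq> l2"
    and v: "v1 \<in> eigenspace z l1" "v1 \<noteq> 0" "v2 \<in> eigenspace z l2" "v2 \<noteq> 0"
    by (rule center_two_eigenvalues)
  interpret E1: projective_action scale G T \<alpha> "eigenspace z l1" by (rule eigenspace_action[OF z(1)])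
  interpret E2: projective_action scale G T \<alpha> "eigenspace z l2" by (rule eigenspace_action[OF z(1)])
  obtain \<beta>1 where comm1: "\<And>g h v. \<lbrakk>g \<in> carrier G; h \<in> carrier G; v \<in> eigenspace z l1\<rbrakk> \<Longrightarrow>
    T g (T h v) = \<beta>1 g h *s T h (T g v)"
    using eigenspace_bicharacter[OF z(1,2) v(1,2)] by blast
  obtain \<beta>2 where comm2: "\<And>g h v. \<lbrakk>g \<in> carrier G; h \<in> carrier G; v \<in> eigenspace z l2\<rbrakk> \<Longrightarrow>
    T g (T h v) = \<beta>2 g h *s T h (T g v)"
    using eigenspace_bicharacter[OF z(1,2) v(3,4)] by blast
  interpret b1: alternating_bicharacter G \<beta>1 by (rule E1.commutation_bicharacter[OF comm1 v(1,2)])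
  interpret b2: alternating_bicharacter G \<beta>2 by (rule E2.commutation_bicharacter[OF comm2 v(3,4)])
  let ?R1 = "b1.perp (carrier G)" and ?R2 = "b2.perp (carrier G)"
  have "?R2 \<inter> ?R1 \<subseteq> Z"
  proof
    fix g assume g: "g \<in> ?R2 \<inter> ?R1"
    then have gG: "g \<in> carrier G" by (simp add: b1.perp_def)
    show "g \<in> Z"
    proof (rule radicals_meet_in_center[OF z v gG])
      fix h v assume "h \<in> carrier G" "v \<in> eigenspace z l1 \<union> eigenspace z l2"
      then show "T g (T h v) = T h (T g v)"
        using comm1[of g h v] comm2[of g h v] g gG by (auto simp: b1.perp_def b2.perp_def)
    qed
  qed
  moreover have "finite Z" using card_Z p2 by (intro card_ge_0_finite) simp
  ultimately have "card (?R2 \<inter> ?R1) \<le> p" using card_mono[of Z] card_Z by metis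
  then have RR: "card ?R2 * card ?R1 \<le> card (carrier G) * p"
    using b1.card_radical_inter[OF b2.subgroup_perp[OF subset_refl]] by (meson le_trans mult_le_mono2)
  obtain A1 N1 u1 where A1: "subgroup A1 G" "card A1 ^ 2 = card (carrier G) * card ?R1"
    "card (carrier G) = N1 * card A1" "u1 ` {..<N1} \<subseteq> eigenspace z l1" "independent_family {..<N1} u1"
    using E1.independent_orbit[OF comm1 v(1,2)] by blast
  obtain A2 N2 u2 where A2: "subgroup A2 G" "card A2 ^ 2 = card (carrier G) * card ?R2"
    "card (carrier G) = N2 * card A2" "u2 ` {..<N2} \<subseteq> eigenspace z l2" "independent_family {..<N2} u2"
    using E2.independent_orbit[OF comm2 v(3,4)] by blast
  have "card A1 dvd p ^ (2 * n + 1)" "card A2 dvd p ^ (2 * n + 1)"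
    using A1(3) A2(3) card_G by (metis dvd_triv_right)+
  then obtain a1 a2 where a: "a1 \<le> 2 * n + 1" "card A1 = p ^ a1" "a2 \<le> 2 * n + 1" "card A2 = p ^ a2"
    using divides_primepow_nat[OF prime_p] by metis
  have "N1 * p ^ a1 = p ^ (2 * n + 1 - a1) * p ^ a1"
    using A1(3) card_G a(1,2) by (simp flip: power_add)
  then have N1: "N1 = p ^ (2 * n + 1 - a1)" using p2 by simp
  have "N2 * p ^ a2 = p ^ (2 * n + 1 - a2) * p ^ a2"
    using A2(3) card_G a(3,4) by (simp flip: power_add)
  then have N2: "N2 = p ^ (2 * n + 1 - a2)" using p2 by simp
  have "p ^ (2 * a1 + 2 * a2) = card A1 ^ 2 * card A2 ^ 2"
    unfolding a by (simp add: power_add mult.commute flip: power_mult)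
  also have "\<dots> = card (carrier G) ^ 2 * (card ?R2 * card ?R1)"
    unfolding A1(2) A2(2) by (simp add: power2_eq_square)
  also have "\<dots> \<le> card (carrier G) ^ 2 * (card (carrier G) * p)" by (rule mult_le_mono2[OF RR])
  \<comment> \<open>|G|^2 comes from the two Lagrangians and |G| p from the radicals. Halving the
    exponent 6n + 4 bounds a1 + a2 by 3n + 2, which leaves at least n of the total 2 (2n +
    1).\<close>
  also have "\<dots> = p ^ ((2 * n + 1) * 2 + (2 * n + 1) + 1)"
    unfolding card_G by (simp only: power_add power_mult power_one_right mult.assoc)
  finally have "p ^ (2 * a1 + 2 * a2) \<le> p ^ ((2 * n + 1) * 2 + (2 * n + 1) + 1)" .
  then have "2 * a1 + 2 * a2 \<le> (2 * n + 1) * 2 + (2 * n + 1) + 1"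
    by (rule power_le_imp_le_exp[rotated]) (use p2 in linarith)
  then have sum: "n \<le> (2 * n + 1 - a1) + (2 * n + 1 - a2)" using a(1,3) by arith
  have "independent_family ({..<N1} <+> {..<N2}) (case_sum u1 u2)"
    by (rule independent_family_two_eigenspaces[OF linear_T z(3) _ _ A1(5) _ A2(5)])
       (use A1(4) A2(4) in \<open>auto simp: eigenspace_def\<close>)
  moreover have "u1 ` {..<N1} \<subseteq> span B" "u2 ` {..<N2} \<subseteq> span B"
    using A1(4) A2(4) B(2) unfolding eigenspace_def by blast+
  then have "case_sum u1 u2 ` ({..<N1} <+> {..<N2}) \<subseteq> span B" by auto
  ultimately have "card ({..<N1} <+> {..<N2}) \<le> card B"
    by (intro independent_family_card_le B(1)) auto
  then have "N1 + N2 \<le> card B" by (simp add: card_Plus)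
  then show ?thesis using prime_power_sum_ge[OF p2 sum] unfolding N1 N2 by linarith
qed

end

section \<open>Matrices\<close>

text \<open>Vectors of length m become functions vanishing from m on, so matrices of every size act
  on one vector space.\<close>

definition mat_act :: "nat \<Rightarrow> complex mat \<Rightarrow> (nat \<Rightarrow> complex) \<Rightarrow> nat \<Rightarrow> complex" where
  "mat_act m A f = (\<lambda>i. if i < m then \<Sum>j<m. A $$ (i, j) * f j else 0)"

definition supported :: "nat \<Rightarrow> (nat \<Rightarrow> complex) set" where
  "supported m = {f. \<forall>i\<ge>m. f i = 0}"

definition unit_fun :: "nat \<Rightarrow> nat \<Rightarrow> complex" where
  "unit_fun j = (\<lambda>i. if i = j then 1 else 0)"

lemma linear_mat_act:
  "Vector_Spaces.linear (\<lambda>(c::complex) f x. c * f x) (\<lambda>c f x. c * f x) (mat_act m A)"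
  by unfold_locales (auto simp: mat_act_def fun_eq_iff algebra_simps sum.distrib sum_distrib_left)

lemma mat_act_mult:
  assumes "A \<in> carrier_mat m m" "B \<in> carrier_mat m m"
  shows "mat_act m (A * B) f = mat_act m A (mat_act m B f)"
proof
  fix i
  show "mat_act m (A * B) f i = mat_act m A (mat_act m B f) i"
  proof (cases "i < m")
    case True
    have "mat_act m (A * B) f i = (\<Sum>j<m. \<Sum>k<m. A $$ (i, k) * B $$ (k, j) * f j)"
      using assms True by (simp add: mat_act_def scalar_prod_def atLeast0LessThan sum_distrib_right)
    also have "\<dots> = (\<Sum>k<m. \<Sum>j<m. A $$ (i, k) * B $$ (k, j) * f j)" by (rule sum.swap)
    also have "\<dots> = mat_act m A (mat_act m B f) i"
      using True by (simp add: mat_act_def sum_distrib_left mult.assoc)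
    finally show ?thesis .
  qed (simp add: mat_act_def)
qed

lemma mat_act_smult: "A \<in> carrier_mat m m \<Longrightarrow> mat_act m (c \<cdot>\<^sub>m A) f = (\<lambda>i. c * mat_act m A f i)"
  by (auto simp: mat_act_def fun_eq_iff sum_distrib_left mult.assoc intro!: sum.cong)

lemma mat_act_one:
  assumes "f \<in> supported m"
  shows "mat_act m (1\<^sub>m m) f = f"
proof
  fix i
  have "(\<Sum>j<m. (1\<^sub>m m :: complex mat) $$ (i, j) * f j) = (\<Sum>j<m. if j = i then f j else 0)" if "i < m"
    using that by (intro sum.cong) auto
  then show "mat_act m (1\<^sub>m m) f i = f i" using assms by (auto simp: mat_act_def supported_def)
qed

lemma mat_act_unit: "j < m \<Longrightarrow> i < m \<Longrightarrow> mat_act m A (unit_fun j) i = A $$ (i, j)"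
proof -
  assume "j < m" "i < m"
  then have "mat_act m A (unit_fun j) i = (\<Sum>k<m. if k = j then A $$ (i, k) else 0)"
    by (simp add: mat_act_def unit_fun_def if_distrib cong: if_cong)
  with \<open>j < m\<close> show ?thesis by simp
qed

lemma mat_act_vec:
  assumes "A \<in> carrier_mat m m" "w \<in> carrier_vec m"
  shows "mat_act m A (\<lambda>i. if i < m then w $ i else 0) = (\<lambda>i. if i < m then (A *\<^sub>v w) $ i else 0)"
  using assms by (auto simp: mat_act_def fun_eq_iff scalar_prod_def atLeast0LessThan intro!: sum.cong)

lemma subspace_supported: "fun_space.subspace (supported m)"
  by (auto simp: fun_space.subspace_def supported_def)

lemma supported_subset_span: "supported m \<subseteq> fun_space.span (unit_fun ` {..<m})"
proof
  fix f :: "nat \<Rightarrow> complex" assume f: "f \<in> supported m"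
  have "f = (\<Sum>j<m. (\<lambda>x. f j * unit_fun j x))"
  proof
    fix i
    have "(\<Sum>j<m. (\<lambda>x. f j * unit_fun j x)) i = (\<Sum>j<m. f j * unit_fun j i)"
      by (induction m) auto
    also have "\<dots> = (\<Sum>j<m. if j = i then f j else 0)" by (intro sum.cong) (auto simp: unit_fun_def)
    also have "\<dots> = f i" using f by (auto simp: supported_def)
    finally show "f i = (\<Sum>j<m. (\<lambda>x. f j * unit_fun j x)) i" ..
  qed
  also have "\<dots> \<in> fun_space.span (unit_fun ` {..<m})"
    by (intro fun_space.span_sum fun_space.span_scale fun_space.span_base) auto
  finally show "f \<in> fun_space.span (unit_fun ` {..<m})" .
qed

section \<open>From matrix representations to projective actions\<close>

lemma (in extra_special_character) faithful_proj_action: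
  assumes card: "card (carrier G) = p ^ (2 * n + 1)" and "n > 1"
    and rep: "proj_rep G m \<rho>" and faith: "faithful_proj G m \<rho>"
  obtains \<alpha> where "extra_special_action G p \<chi> (\<lambda>c f x. c * f x) (\<lambda>g. mat_act m (\<rho> g)) \<alpha> (supported m) n"
proof -
  obtain \<alpha> where \<alpha>: "cocycle2 G \<alpha>" "alpha_rep G m \<alpha> \<rho>" using rep by (auto simp: proj_rep_def)
  have carr: "\<rho> g \<in> carrier_mat m m" if "g \<in> carrier G" for g
    using \<alpha>(2) that by (simp add: alpha_rep_def)
  have "projective_action (\<lambda>c f x. c * f x) G (\<lambda>g. mat_act m (\<rho> g)) \<alpha> (supported m)"
  proof (intro projective_action.intro projective_action_axioms.intro)
    show "complex_vector_space (\<lambda>(c::complex) (f::nat \<Rightarrow> complex) x. c * f x)" "group G" by unfold_locales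
    show "finite (carrier G)" by (rule finite_G)
    show "Vector_Spaces.linear (\<lambda>(c::complex) f x. c * f x) (\<lambda>c f x. c * f x) (mat_act m (\<rho> g))" for g
      by (rule linear_mat_act)
    show "fun_space.subspace (supported m)" by (rule subspace_supported)
    show "mat_act m (\<rho> g) v \<in> supported m" for g v by (simp add: mat_act_def supported_def)
    show "mat_act m (\<rho> \<one>) v = v" if "v \<in> supported m" for v
      using \<alpha>(2) mat_act_one[OF that] by (simp add: alpha_rep_def)
    show "mat_act m (\<rho> g) (mat_act m (\<rho> h) v) = (\<lambda>x. \<alpha> g h * mat_act m (\<rho> (g \<otimes> h)) v x)"
      if gh: "g \<in> carrier G" "h \<in> carrier G" for g h v
    proof -
      have "mat_act m (\<rho> g) (mat_act m (\<rho> h) v) = mat_act m (\<rho> g * \<rho> h) v"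
        using gh carr by (simp add: mat_act_mult)
      also have "\<rho> g * \<rho> h = \<alpha> g h \<cdot>\<^sub>m \<rho> (g \<otimes> h)" using \<alpha>(2) gh by (simp add: alpha_rep_def)
      finally show ?thesis using gh by (simp add: mat_act_smult[OF carr])
    qed
    show "\<alpha> g h \<noteq> 0" if "g \<in> carrier G" "h \<in> carrier G" for g h
      using \<alpha>(1) that by (simp add: cocycle2_def)
  qed
  moreover have "extra_special_action_axioms G p (\<lambda>c f x. c * f x) (\<lambda>g. mat_act m (\<rho> g)) (supported m) n"
  proof
    show "False" if g: "g \<in> carrier G" "g \<noteq> \<one>"
      and l: "\<forall>v\<in>supported m. mat_act m (\<rho> g) v = (\<lambda>x. l * v x)" for g l
    proof -
      \<comment> \<open>Acting as l on the unit functions determines every column of the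
        matrix.\<close>
      have "\<rho> g = l \<cdot>\<^sub>m 1\<^sub>m m"
      proof (rule eq_matI)
        fix i j assume "i < dim_row (l \<cdot>\<^sub>m 1\<^sub>m m)" "j < dim_col (l \<cdot>\<^sub>m 1\<^sub>m m)"
        then have ij: "i < m" "j < m" by auto
        then have "unit_fun j \<in> supported m" by (auto simp: unit_fun_def supported_def)
        then have "mat_act m (\<rho> g) (unit_fun j) i = l * unit_fun j i" using l by simp
        then have "\<rho> g $$ (i, j) = l * unit_fun j i" using mat_act_unit[OF ij(2,1)] by simp
        then show "\<rho> g $$ (i, j) = (l \<cdot>\<^sub>m 1\<^sub>m m) $$ (i, j)"
          using ij by (simp add: unit_fun_def)
      qed (use carr[OF g(1)] in auto)
      then show False using faith g by (auto simp: faithful_proj_def is_scalar_mat_def)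
    qed
  qed (fact card, fact \<open>n > 1\<close>)
  ultimately show thesis
    by (intro that extra_special_action.intro extra_special_character_axioms)
qed

lemma (in extra_special_character) faithful_proj_not_irreducible:
  assumes card: "card (carrier G) = p ^ (2 * n + 1)" "n > 1"
    and rep: "proj_rep G m \<rho>" "faithful_proj G m \<rho>"
  shows "\<not> irreducible_proj G m \<rho>"
proof
  assume irr: "irreducible_proj G m \<rho>"
  have carr: "\<rho> g \<in> carrier_mat m m" if "g \<in> carrier G" for g
    using rep(1) that by (auto simp: proj_rep_def alpha_rep_def)
  obtain \<alpha> where "extra_special_action G p \<chi> (\<lambda>c f x. c * f x) (\<lambda>g. mat_act m (\<rho> g)) \<alpha> (supported m) n"
    by (rule faithful_proj_action[OF card rep])
  then interpret act: extra_special_action G p \<chi> "\<lambda>c f x. c * f x" "\<lambda>g. mat_act m (\<rho> g)" \<alpha> "supported m" n .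
  obtain W where W: "fun_space.subspace W" "W \<subseteq> supported m"
    "\<forall>g\<in>carrier G. \<forall>v\<in>W. mat_act m (\<rho> g) v \<in> W" "\<exists>v\<in>W. v \<noteq> 0" "W \<noteq> supported m"
    using act.proper_invariant_subspace by blast
  define fn where "fn w = (\<lambda>i. if i < m then w $ i else 0)" for w :: "complex vec"
  have fn_vec: "fn (vec m f) = f" if "f \<in> supported m" for f
    using that by (auto simp: fn_def supported_def fun_eq_iff)
  \<comment> \<open>Carries W back to vectors. As \<open>fn (vec m f) = f\<close> for supported f, U
    is neither zero nor everything.\<close>
  define U where "U = {w \<in> carrier_vec m. fn w \<in> W}"
  have "is_subspace m U"
    unfolding is_subspace_def
  proof (intro conjI ballI allI)
    show "U \<subseteq> carrier_vec m" by (auto simp: U_def)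
    have "fn (0\<^sub>v m) = 0" by (auto simp: fn_def fun_eq_iff)
    then show "0\<^sub>v m \<in> U" using fun_space.subspace_0[OF W(1)] by (simp add: U_def)
    show "v + w \<in> U" if "v \<in> U" "w \<in> U" for v w
    proof -
      have "fn (v + w) = fn v + fn w" using that by (auto simp: fn_def fun_eq_iff U_def)
      then show ?thesis using that fun_space.subspace_add[OF W(1)] by (auto simp: U_def)
    qed
    show "c \<cdot>\<^sub>v v \<in> U" if "v \<in> U" for c v
    proof -
      have "fn (c \<cdot>\<^sub>v v) = (\<lambda>x. c * fn v x)" using that by (auto simp: fn_def fun_eq_iff U_def)
      then show ?thesis using that fun_space.subspace_scale[OF W(1)] by (auto simp: U_def)
    qed
  qed
  moreover have "\<rho> g *\<^sub>v w \<in> U" if "g \<in> carrier G" "w \<in> U" for g w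
  proof -
    have w: "w \<in> carrier_vec m" "fn w \<in> W" using that by (auto simp: U_def)
    have "fn (\<rho> g *\<^sub>v w) = mat_act m (\<rho> g) (fn w)"
      unfolding fn_def using mat_act_vec[OF carr[OF that(1)] w(1)] by simp
    then show ?thesis using W(3) that(1) w carr[OF that(1)] by (simp add: U_def)
  qed
  ultimately have "U = {0\<^sub>v m} \<or> U = carrier_vec m"
    using irr unfolding irreducible_proj_def by blast
  then show False
  proof
    assume U: "U = {0\<^sub>v m}"
    obtain v where v: "v \<in> W" "v \<noteq> 0" using W(4) by blast
    then have fv: "fn (vec m v) = v" using W(2) fn_vec by blast
    then have "vec m v \<in> U" using v by (simp add: U_def)
    then have "v = fn (0\<^sub>v m)" using U fv by auto
    also have "\<dots> = 0" by (auto simp: fn_def fun_eq_iff)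
    finally show False using v by simp
  next
    assume U: "U = carrier_vec m"
    have "f \<in> W" if "f \<in> supported m" for f
    proof -
      have "vec m f \<in> U" using U by simp
      then show ?thesis using fn_vec[OF that] by (simp add: U_def)
    qed
    then show False using W(2,5) by blast
  qed
qed

theorem theorem4p11:
  fixes G :: "('a, 'b) monoid_scheme" and p n :: nat
  assumes "extra_special p G"
    and "card (carrier G) = p ^ (2 * n + 1)"
    and "n > 1"
  shows "\<not> (\<exists>m \<rho>. proj_rep G m \<rho> \<and> faithful_proj G m \<rho> \<and> irreducible_proj G m \<rho>)
    \<and> tau G = (if even n then 2 * p ^ (n div 2) else p ^ ((n + 1) div 2) + p ^ ((n - 1) div 2))"
proof -
  interpret extra_special_group G p
    using assms(1) by (auto simp: extra_special_group_def extra_special_group_axioms_def extra_special_def)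
  obtain \<chi> where "extra_special_character G p \<chi>" by (rule faithful_center_character)
  then interpret extra_special_character G p \<chi> .
  \<comment> \<open>The balanced exponents cover both parities in one formula; the value is attained
    by splitting G with \<open>s = n div 2\<close>.\<close>
  have "tau G = p ^ (n - n div 2) + p ^ (n div 2)"
    unfolding tau_def
  proof (rule Least_equality)
    show "\<exists>\<rho>. proj_rep G (p ^ (n - n div 2) + p ^ (n div 2)) \<rho> \<and>
        faithful_proj G (p ^ (n - n div 2) + p ^ (n div 2)) \<rho>"
      by (rule faithful_projective_exists[OF assms(2)]) simp
  next
    fix m assume "\<exists>\<rho>. proj_rep G m \<rho> \<and> faithful_proj G m \<rho>"
    then obtain \<rho> where rep: "proj_rep G m \<rho>" "faithful_proj G m \<rho>" by blast
    obtain \<alpha> where "extra_special_action G p \<chi> (\<lambda>c f x. c * f x) (\<lambda>g. mat_act m (\<rho> g)) \<alpha> (supported m) n"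
      by (rule faithful_proj_action[OF assms(2,3) rep])
    then interpret act: extra_special_action G p \<chi> "\<lambda>c f x. c * f x" "\<lambda>g. mat_act m (\<rho> g)" \<alpha> "supported m" n .
    have "p ^ (n - n div 2) + p ^ (n div 2) \<le> card (unit_fun ` {..<m})"
      by (rule act.degree_lower_bound[OF _ supported_subset_span]) simp
    also have "\<dots> \<le> m" using card_image_le[of "{..<m}" unit_fun] by simp
    finally show "p ^ (n - n div 2) + p ^ (n div 2) \<le> m" .
  qed
  also have "\<dots> = (if even n then 2 * p ^ (n div 2) else p ^ ((n + 1) div 2) + p ^ ((n - 1) div 2))"
    by (auto elim!: evenE oddE)
  finally show ?thesis using faithful_proj_not_irreducible[OF assms(2,3)] by blast
qed

end
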